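(* Let $k\ge1$, let $A_i,B_{i1},\ldots,B_{ik}\in\mathbb{C}^{m_i\times n_i}$ with $m_i\ge n_i$ for $1\le i\le k$, and let $N=n_1n_2\cdots n_k$. Let $\widetilde\theta_N$ and $\varphi$ be the infima defined in the context, and for each $i$ let $[A_i,B_{i1},\ldots,B_{ik}]=U^i\Sigma^i(V^i)^{H}$ be an SVD partitioned as in the context. Suppose that $\|V_{11}^i\|_2<1$ for $i=1,\ldots,k$, and that the (square) multiparameter eigenvalue problem $$(V_{11}^i)^{H}\mathbf{x}_i=\lambda_1(V_{21}^i)^{H}\mathbf{x}_i+\cdots+\lambda_k(V_{k+1\,1}^i)^{H}\mathbf{x}_i,\qquad 1\le i\le k,$$ has $N$ linearly independent eigenvectors $\mathbf{z}_j=\mathbf{x}_{1,j}\otimes\mathbf{x}_{2,j}\otimes\cdots\otimes\mathbf{x}_{k,j}$, $j=1,\ldots,N$; that is, for each $j$ there are $\lambda_{1,j},\ldots,\lambda_{k,j}\in\mathbb{C}$ and nonzero $\mathbf{x}_{i,j}\in\mathbb{C}^{n_i}$ ($1\le i\le k$) satisfying these $k$ equations, and $\mathbf{z}_1,\ldots,\mathbf{z}_N$ are linearly independent. Then $\varphi=\widetilde\theta_N$.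
   Context: Notation: $\|\cdot\|_F$ is the Frobenius norm, $\|\cdot\|_2$ the spectral norm, $M^{H}$ the conjugate transpose, $\otimes$ the Kronecker product, and $[M_0,\ldots,M_k]$ horizontal concatenation. Definition of $\widetilde\theta_N$: $$\widetilde\theta_N=\inf\ \sum_{i=1}^k\big\|[\widehat A_i-A_i,\widehat B_{i1}-B_{i1},\ldots,\widehat B_{ik}-B_{ik}]\big\|_F^2$$ over all $\widehat A_i,\widehat B_{is}\in\mathbb{C}^{m_i\times n_i}$ ($1\le i,s\le k$), $\lambda_{s,j}\in\mathbb{C}$ and $\mathbf{x}_{i,j}\in\mathbb{C}^{n_i}$ ($1\le i,s\le k$, $1\le j\le N$) subject to: (i) $\widehat A_i\mathbf{x}_{i,j}=\sum_{s=1}^k\lambda_{s,j}\widehat B_{is}\mathbf{x}_{i,j}$ for $1\le i\le k$, $1\le j\le N$; (ii) the vectors $\mathbf{x}_{1,j}\otimes\cdots\otimes\mathbf{x}_{k,j}$, $j=1,\ldots,N$, are linearly independent; (iii) $\operatorname{rank}([\widehat A_i,\widehat B_{i1},\ldots,\widehat B_{ik}])\le n_i$ for $1\le i\le k$. Definition of $\varphi$: $$\varphi=\inf\ \sum_{i=1}^k\big\|[\widehat A_i-A_i,\widehat B_{i1}-B_{i1},\ldots,\widehat B_{ik}-B_{ik}]\big\|_F^2$$ over all $\widehat A_i,\widehat B_{is}\in\mathbb{C}^{m_i\times n_i}$ and $X_{is}\in\mathbb{C}^{n_i\times n_i}$ ($1\le i,s\le k$) subject to $\widehat A_i=\widehat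 B_{i1}X_{i1}+\cdots+\widehat B_{ik}X_{ik}$ and $\operatorname{rank}([\widehat A_i,\widehat B_{i1},\ldots,\widehat B_{ik}])\le n_i$ for $1\le i\le k$. SVD partition: with $\widetilde m_i=\min\{m_i,(k+1)n_i\}$, $U^i=[U_1^i,U_2^i]\in\mathbb{C}^{m_i\times\widetilde m_i}$ has orthonormal columns, with $U_1^i\in\mathbb{C}^{m_i\times n_i}$; $V^i\in\mathbb{C}^{(k+1)n_i\times(k+1)n_i}$ is unitary; $\Sigma^i=\begin{bmatrix}\Sigma_1^i&0\\0&\Sigma_2^i\end{bmatrix}\in\mathbb{R}^{\widetilde m_i\times(k+1)n_i}$, where $\Sigma_1^i\in\mathbb{R}^{n_i\times n_i}$ is diagonal containing the $n_i$ largest singular values of $[A_i,B_{i1},\ldots,B_{ik}]$ and $\Sigma_2^i\in\mathbb{R}^{(\widetilde m_i-n_i)\times kn_i}$ carries the remaining singular values on its main diagonal and is zero elsewhere. $V^i$ is partitioned into $k+1$ block rows of $n_i$ rows each, and two block columns of $n_i$ and $kn_i$ columns: the blocks of the $r$th block row are $V^i_{r1}\in\mathbb{C}^{n_i\times n_i}$ and $V^i_{r2}\in\mathbb{C}^{n_i\times kn_i}$, $1\le r\le k+1$ (so $V^i_{k+1\,1}$ is the last block of the first block column). *)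

theory Defs
  imports
    "Jordan_Normal_Form.Schur_Decomposition"
    "Jordan_Normal_Form.DL_Rank"
    "HOL-Analysis.L2_Norm"
    "HOL-Library.Extended_Real"
begin

text \<open>
  All indices \<open>i\<close>, \<open>s\<close>, \<open>j\<close> are 1-based, as usual for multiparameter eigenvalue problems; families
  of matrices are functions on \<open>nat\<close> whose values outside the index range are irrelevant.
  Entries within a matrix or a vector are 0-based.
\<close>

section \<open>Norms, concatenation, Kronecker products\<close>

definition frobenius_norm :: "complex mat \<Rightarrow> real" where
  "frobenius_norm M = L2_set (\<lambda>p. cmod (M $$ p)) ({..<dim_row M} \<times> {..<dim_col M})"

definition euclid_norm :: "complex vec \<Rightarrow> real" where
  "euclid_norm v = L2_set (\<lambda>r. cmod (v $ r)) {..<dim_vec v}"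

definition spectral_norm :: "complex mat \<Rightarrow> real" where
  "spectral_norm M =
     Sup {euclid_norm (M *\<^sub>v v) | v. v \<in> carrier_vec (dim_col M) \<and> euclid_norm v \<le> 1}"

definition hconcat :: "nat \<Rightarrow> complex mat list \<Rightarrow> complex mat" where
  "hconcat nr Ms = mat_of_cols nr (concat (map cols Ms))"

definition coeff_row :: "nat \<Rightarrow> nat \<Rightarrow> complex mat \<Rightarrow> (nat \<Rightarrow> complex mat) \<Rightarrow> complex mat" where
  "coeff_row k nr A B = hconcat nr (A # map B [1..<Suc k])"

definition kron_vec :: "complex vec \<Rightarrow> complex vec \<Rightarrow> complex vec" where
  "kron_vec v w = vec (dim_vec v * dim_vec w) (\<lambda>r. v $ (r div dim_vec w) * w $ (r mod dim_vec w))"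

text \<open>The one-entry vector \<open>(1)\<close> is the unit of \<^const>\<open>kron_vec\<close>.\<close>

definition kron_vecs :: "complex vec list \<Rightarrow> complex vec" where
  "kron_vecs vs = foldr kron_vec vs (vec 1 (\<lambda>_. 1))"

text \<open>Independence of an indexed family: repeated members make the family dependent, hence the
  injectivity condition on top of independence of the set of its members.\<close>

definition lin_indpt_family :: "nat \<Rightarrow> 'j set \<Rightarrow> ('j \<Rightarrow> complex vec) \<Rightarrow> bool" where
  "lin_indpt_family d J z \<longleftrightarrow>
     z ` J \<subseteq> carrier_vec d \<and> inj_on z J \<and>
     module.lin_indpt class_ring (module_vec TYPE(complex) d) (z ` J)"

section \<open>Multiparameter eigenvalue problems\<close>

definition mep_coeffs ::
  "nat \<Rightarrow> (nat \<Rightarrow> nat) \<Rightarrow> (nat \<Rightarrow> nat) \<Rightarrow> (nat \<Rightarrow> complex mat) \<Rightarrow> (nat \<Rightarrow> nat \<Rightarrow> complex mat) \<Rightarrow> bool"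
where
  "mep_coeffs k m n A B \<longleftrightarrow>
     (\<forall>i\<in>{1..k}. A i \<in> carrier_mat (m i) (n i) \<and>
                 (\<forall>s\<in>{1..k}. B i s \<in> carrier_mat (m i) (n i)))"

text \<open>The vectors \<open>x i j\<close> and scalars \<open>lam s j\<close>, for \<open>j = 1..N\<close>, form \<open>N\<close> eigentuples of the problem
  \<open>A i x = (\<Sum>s. lam s * B i s x)\<close> whose Kronecker products are linearly independent
  (so in particular nonzero).\<close>

definition indep_eigentuples ::
  "nat \<Rightarrow> (nat \<Rightarrow> nat) \<Rightarrow> (nat \<Rightarrow> nat) \<Rightarrow> (nat \<Rightarrow> complex mat) \<Rightarrow> (nat \<Rightarrow> nat \<Rightarrow> complex mat) \<Rightarrow> nat \<Rightarrow>
   (nat \<Rightarrow> nat \<Rightarrow> complex) \<Rightarrow> (nat \<Rightarrow> nat \<Rightarrow> complex vec) \<Rightarrow> bool"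
where
  "indep_eigentuples k m n A B N lam x \<longleftrightarrow>
     (\<forall>i\<in>{1..k}. \<forall>j\<in>{1..N}. x i j \<in> carrier_vec (n i)) \<and>
     (\<forall>i\<in>{1..k}. \<forall>j\<in>{1..N}.
        A i *\<^sub>v x i j =
        finsum_vec TYPE(complex) (m i) (\<lambda>s. lam s j \<cdot>\<^sub>v (B i s *\<^sub>v x i j)) {1..k}) \<and>
     lin_indpt_family (\<Prod>i\<in>{1..k}. n i) {1..N} (\<lambda>j. kron_vecs (map (\<lambda>i. x i j) [1..<Suc k]))"

definition perturbation_cost ::
  "nat \<Rightarrow> (nat \<Rightarrow> nat) \<Rightarrow> (nat \<Rightarrow> complex mat) \<Rightarrow> (nat \<Rightarrow> nat \<Rightarrow> complex mat) \<Rightarrow>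
   (nat \<Rightarrow> complex mat) \<Rightarrow> (nat \<Rightarrow> nat \<Rightarrow> complex mat) \<Rightarrow> real"
where
  "perturbation_cost k m A B Ah Bh =
     (\<Sum>i\<in>{1..k}. (frobenius_norm (coeff_row k (m i) (Ah i - A i) (\<lambda>s. Bh i s - B i s)))\<^sup>2)"

definition rank_constraint ::
  "nat \<Rightarrow> (nat \<Rightarrow> nat) \<Rightarrow> (nat \<Rightarrow> nat) \<Rightarrow> (nat \<Rightarrow> complex mat) \<Rightarrow> (nat \<Rightarrow> nat \<Rightarrow> complex mat) \<Rightarrow> bool"
where
  "rank_constraint k m n Ah Bh \<longleftrightarrow>
     (\<forall>i\<in>{1..k}. vec_space.rank (m i) (coeff_row k (m i) (Ah i) (Bh i)) \<le> n i)"

text \<open>The infima are taken in \<^typ>\<open>ereal\<close>, so that an empty feasible set would give \<open>\<infinity>\<close>.\<close>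

definition theta_tilde ::
  "nat \<Rightarrow> (nat \<Rightarrow> nat) \<Rightarrow> (nat \<Rightarrow> nat) \<Rightarrow> (nat \<Rightarrow> complex mat) \<Rightarrow> (nat \<Rightarrow> nat \<Rightarrow> complex mat) \<Rightarrow> nat \<Rightarrow> ereal"
where
  "theta_tilde k m n A B N =
     Inf {ereal (perturbation_cost k m A B Ah Bh) | Ah Bh lam x.
            mep_coeffs k m n Ah Bh \<and>
            indep_eigentuples k m n Ah Bh N lam x \<and>
            rank_constraint k m n Ah Bh}"

definition phi ::
  "nat \<Rightarrow> (nat \<Rightarrow> nat) \<Rightarrow> (nat \<Rightarrow> nat) \<Rightarrow> (nat \<Rightarrow> complex mat) \<Rightarrow> (nat \<Rightarrow> nat \<Rightarrow> complex mat) \<Rightarrow> ereal"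
where
  "phi k m n A B =
     Inf {ereal (perturbation_cost k m A B Ah Bh) | Ah Bh X.
            mep_coeffs k m n Ah Bh \<and>
            (\<forall>i\<in>{1..k}. \<forall>s\<in>{1..k}. X i s \<in> carrier_mat (n i) (n i)) \<and>
            (\<forall>i\<in>{1..k}.
               Ah i = finsum (module_mat TYPE(complex) (m i) (n i)) (\<lambda>s. Bh i s * X i s) {1..k}) \<and>
            rank_constraint k m n Ah Bh}"

section \<open>Partitioned singular value decomposition\<close>

text \<open>Economy-size SVD \<open>M = U S V\<^sup>H\<close> of an \<open>m \<times> q\<close> matrix, with \<open>S\<close> of size \<open>min m q \<times> q\<close>. The singular
  values in the leading \<open>n \<times> n\<close> block of \<open>S\<close> are the \<open>n\<close> largest ones; nothing is required about
  the order inside the leading block or among the remaining singular values.\<close>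

definition svd_split ::
  "nat \<Rightarrow> nat \<Rightarrow> nat \<Rightarrow> complex mat \<Rightarrow> complex mat \<Rightarrow> real mat \<Rightarrow> complex mat \<Rightarrow> bool"
where
  "svd_split m q n M U S V \<longleftrightarrow>
     U \<in> carrier_mat m (min m q) \<and> mat_adjoint U * U = 1\<^sub>m (min m q) \<and>
     V \<in> carrier_mat q q \<and> mat_adjoint V * V = 1\<^sub>m q \<and> V * mat_adjoint V = 1\<^sub>m q \<and>
     S \<in> carrier_mat (min m q) q \<and> diagonal_mat S \<and>
     (\<forall>r<min m q. 0 \<le> S $$ (r, r)) \<and>
     (\<forall>a b. a < n \<and> n \<le> b \<and> b < min m q \<longrightarrow> S $$ (b, b) \<le> S $$ (a, a)) \<and>
     M = U * map_mat complex_of_real S * mat_adjoint V"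

text \<open>The block \<open>V\<^bsub>r1\<^esub>\<close> (\<open>r = 1, 2, \<dots>\<close>): the \<open>r\<close>-th group of \<open>n\<close> rows, first \<open>n\<close> columns.\<close>

definition block_r1 :: "nat \<Rightarrow> complex mat \<Rightarrow> nat \<Rightarrow> complex mat" where
  "block_r1 n V r = mat n n (\<lambda>(a, b). V $$ ((r - 1) * n + a, b))"

end

theory Submission
  imports Defs
begin

text \<open>
  Both infima are attained at the truncated SVD. By the Eckart--Young theorem the rank constraint
  alone forces the cost to be at least that of the best rank-\<open>n\<^sub>i\<close> approximations
  \<open>L\<^sub>i [(V\<^sub>1\<^sub>1)\<^sup>H, \<dots>, (V\<^bsub>k+1 1\<^esub>)\<^sup>H]\<close>, where \<open>L\<^sub>i\<close> is the leading part of \<open>U\<^sup>i \<Sigma>\<^sup>i\<close>.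
  Multiplying by \<open>L\<^sub>i\<close> keeps the eigentuples of the square problem, so this point is feasible for
  \<open>theta_tilde\<close>. It is feasible for \<open>phi\<close> because \<open>\<parallel>V\<^sub>1\<^sub>1\<parallel> < 1\<close> makes
  \<open>W = \<Sum>\<^sub>s (V\<^bsub>s+1 1\<^esub>)\<^sup>H V\<^bsub>s+1 1\<^esub> = I - (V\<^sub>1\<^sub>1)\<^sup>H V\<^sub>1\<^sub>1\<close> invertible, and then
  \<open>X\<^sub>s = V\<^bsub>s+1 1\<^esub> W\<^sup>-\<^sup>1 (V\<^sub>1\<^sub>1)\<^sup>H\<close> works.

  Eckart--Young: write a competitor as \<open>Q C\<close> with orthonormal columns in \<open>Q\<close>. Then
  \<open>\<parallel>M - Q C\<parallel>\<^sup>2 \<ge> \<parallel>M\<parallel>\<^sup>2 - \<parallel>Q\<^sup>H M\<parallel>\<^sup>2\<close>, and \<open>\<parallel>Q\<^sup>H M\<parallel>\<^sup>2\<close> is a sum of the squared singular values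
  with weights \<open>\<parallel>Q\<^sup>H u\<^sub>r\<parallel>\<^sup>2\<close> in \<open>[0, 1]\<close> of total at most \<open>n\<close>.
\<close>

section \<open>The Frobenius inner product\<close>

text \<open>Conjugate-linear in the first argument and complex-valued, so that a left factor can
  pass to the other argument as its adjoint. The norm identities below then become algebra with this
  form.\<close>

definition mat_inner :: "complex mat \<Rightarrow> complex mat \<Rightarrow> complex" where
  "mat_inner X Y = (\<Sum>i<dim_row X. \<Sum>j<dim_col X. cnj (X $$ (i, j)) * Y $$ (i, j))"

section \<open>Adjoints and entries of products\<close>

lemma mat_adjoint_dim [simp]:
  "dim_row (mat_adjoint M) = dim_col M" "dim_col (mat_adjoint M) = dim_row M"
  by (simp_all add: mat_adjoint_def)

lemma mat_adjoint_carrier [simp, intro]: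
  "M \<in> carrier_mat a b \<Longrightarrow> mat_adjoint M \<in> carrier_mat b a"
  by (intro carrier_matI) simp_all

lemma mat_adjoint_index [simp]:
  fixes M :: "complex mat"
  assumes "i < dim_col M" "j < dim_row M"
  shows "mat_adjoint M $$ (i, j) = cnj (M $$ (j, i))"
  using assms by (simp add: mat_adjoint_def mat_of_rows_index)

lemma mat_adjoint_adjoint [simp]: "mat_adjoint (mat_adjoint M) = (M :: complex mat)"
  by (rule eq_matI) auto

lemma mat_mult_index_sum:
  assumes "X \<in> carrier_mat a b" "Y \<in> carrier_mat b c" "i < a" "j < c"
  shows "(X * Y) $$ (i, j) = (\<Sum>l<b. X $$ (i, l) * Y $$ (l, j))"
  unfolding lessThan_atLeast0 using assms by (auto simp: scalar_prod_def intro!: sum.cong simp del: atLeast0LessThan)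

lemma mat_vec_index_sum:
  assumes "X \<in> carrier_mat a b" "v \<in> carrier_vec b" "i < a"
  shows "(X *\<^sub>v v) $ i = (\<Sum>l<b. X $$ (i, l) * v $ l)"
  unfolding lessThan_atLeast0 using assms by (auto simp: scalar_prod_def intro!: sum.cong simp del: atLeast0LessThan)

lemma mat_adjoint_mult:
  assumes X: "X \<in> carrier_mat a b" and Y: "(Y :: complex mat) \<in> carrier_mat b c"
  shows "mat_adjoint (X * Y) = mat_adjoint Y * mat_adjoint X"
proof (rule eq_matI)
  fix i j assume "i < dim_row (mat_adjoint Y * mat_adjoint X)" "j < dim_col (mat_adjoint Y * mat_adjoint X)"
  then have ij: "i < c" "j < a" using X Y by auto
  have "mat_adjoint (X * Y) $$ (i, j) = cnj ((X * Y) $$ (j, i))"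
    using X Y ij by (intro mat_adjoint_index) auto
  also have "\<dots> = (\<Sum>l<b. mat_adjoint Y $$ (i, l) * mat_adjoint X $$ (l, j))"
    unfolding mat_mult_index_sum[OF X Y ij(2) ij(1)] using X Y ij
    by (auto intro!: sum.cong)
  also have "\<dots> = (mat_adjoint Y * mat_adjoint X) $$ (i, j)"
    using mat_mult_index_sum[of "mat_adjoint Y" c b "mat_adjoint X" a i j] X Y ij by auto
  finally show "mat_adjoint (X * Y) $$ (i, j) = (mat_adjoint Y * mat_adjoint X) $$ (i, j)" .
qed (use X Y in auto)

section \<open>Algebra of the inner product and the norm it induces\<close>

lemma mat_inner_cnj:
  assumes "X \<in> carrier_mat a b" "Y \<in> carrier_mat a b"
  shows "cnj (mat_inner X Y) = mat_inner Y X"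
  using assms by (auto simp: mat_inner_def mult.commute intro!: sum.cong)

lemma mat_inner_diff_right:
  assumes "X \<in> carrier_mat a b" "Y \<in> carrier_mat a b" "Z \<in> carrier_mat a b"
  shows "mat_inner X (Y - Z) = mat_inner X Y - mat_inner X Z"
  using assms by (auto simp: mat_inner_def right_diff_distrib sum_subtractf[symmetric] intro!: sum.cong)

lemma mat_inner_diff_left:
  assumes "X \<in> carrier_mat a b" "Y \<in> carrier_mat a b" "Z \<in> carrier_mat a b"
  shows "mat_inner (Y - Z) X = mat_inner Y X - mat_inner Z X"
  using assms by (auto simp: mat_inner_def left_diff_distrib sum_subtractf[symmetric] intro!: sum.cong)

lemma mat_inner_diff_self:
  assumes "X \<in> carrier_mat a b" "Y \<in> carrier_mat a b"
  shows "mat_inner (X - Y) (X - Y) = mat_inner X X - mat_inner X Y - mat_inner Y X + mat_inner Y Y"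
proof -
  have XY: "X - Y \<in> carrier_mat a b" using assms by (auto intro: minus_carrier_mat)
  show ?thesis
    unfolding mat_inner_diff_right[OF XY assms] mat_inner_diff_left[OF assms(1) assms]
      mat_inner_diff_left[OF assms(2) assms] by simp
qed

text \<open>Both sides are the same triple sum over entries of \<open>P\<close>, \<open>X\<close>
  and \<open>Y\<close>; only the order of summation differs.\<close>

lemma mat_inner_mult_left:
  assumes P: "P \<in> carrier_mat a b" and X: "X \<in> carrier_mat b c" and Y: "Y \<in> carrier_mat a c"
  shows "mat_inner (P * X) Y = mat_inner X (mat_adjoint P * Y)"
proof -
  have "mat_inner (P * X) Y = (\<Sum>i<a. \<Sum>j<c. cnj ((P * X) $$ (i, j)) * Y $$ (i, j))"
    using P X by (auto simp: mat_inner_def)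
  also have "\<dots> = (\<Sum>i<a. \<Sum>j<c. \<Sum>l<b. cnj (P $$ (i, l)) * cnj (X $$ (l, j)) * Y $$ (i, j))"
    by (auto simp: mat_mult_index_sum[OF P X] sum_distrib_right simp del: index_mult_mat intro!: sum.cong)
  also have "\<dots> = (\<Sum>l<b. \<Sum>j<c. \<Sum>i<a. cnj (P $$ (i, l)) * cnj (X $$ (l, j)) * Y $$ (i, j))"
  proof -
    have "(\<Sum>i<a. \<Sum>j<c. \<Sum>l<b. g i j l) = (\<Sum>l<b. \<Sum>j<c. \<Sum>i<a. g i j l)"
      for g :: "nat \<Rightarrow> nat \<Rightarrow> nat \<Rightarrow> complex"
    proof -
      have "(\<Sum>i<a. \<Sum>j<c. \<Sum>l<b. g i j l) = (\<Sum>i<a. \<Sum>l<b. \<Sum>j<c. g i j l)"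
        by (rule sum.cong[OF refl], rule sum.swap)
      also have "\<dots> = (\<Sum>l<b. \<Sum>i<a. \<Sum>j<c. g i j l)" by (rule sum.swap)
      also have "\<dots> = (\<Sum>l<b. \<Sum>j<c. \<Sum>i<a. g i j l)"
        by (rule sum.cong[OF refl], rule sum.swap)
      finally show ?thesis .
    qed
    then show ?thesis .
  qed
  also have "\<dots> = (\<Sum>l<b. \<Sum>j<c. cnj (X $$ (l, j)) * (mat_adjoint P * Y) $$ (l, j))"
    using mat_mult_index_sum[of "mat_adjoint P" b a Y c] P Y
    by (auto simp: sum_distrib_left mult_ac simp del: index_mult_mat intro!: sum.cong)
  also have "\<dots> = mat_inner X (mat_adjoint P * Y)"
    using X by (auto simp: mat_inner_def)
  finally show ?thesis .
qed

lemma mat_inner_self: "mat_inner M M = of_real ((frobenius_norm M)\<^sup>2)"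
proof -
  have "(frobenius_norm M)\<^sup>2 = (\<Sum>p\<in>{..<dim_row M} \<times> {..<dim_col M}. (cmod (M $$ p))\<^sup>2)"
    unfolding frobenius_norm_def L2_set_def by (simp add: sum_nonneg)
  also have "\<dots> = (\<Sum>i<dim_row M. \<Sum>j<dim_col M. (cmod (M $$ (i, j)))\<^sup>2)"
    by (simp add: sum.cartesian_product)
  finally show ?thesis
    unfolding mat_inner_def
    by (simp only: of_real_sum complex_norm_square) (simp add: mult.commute)
qed

text \<open>The column index is outermost because orthonormal columns and diagonal right factors are
  treated one column at a time.\<close>

lemma frobenius_norm_sq_sum:
  assumes "M \<in> carrier_mat a b"
  shows "(frobenius_norm M)\<^sup>2 = (\<Sum>j<b. \<Sum>i<a. (cmod (M $$ (i, j)))\<^sup>2)"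
proof -
  have "(frobenius_norm M)\<^sup>2 = (\<Sum>p\<in>{..<a} \<times> {..<b}. (cmod (M $$ p))\<^sup>2)"
    using assms unfolding frobenius_norm_def L2_set_def by (simp add: sum_nonneg)
  also have "\<dots> = (\<Sum>i<a. \<Sum>j<b. (cmod (M $$ (i, j)))\<^sup>2)"
    by (simp add: sum.cartesian_product)
  also have "\<dots> = (\<Sum>j<b. \<Sum>i<a. (cmod (M $$ (i, j)))\<^sup>2)" by (rule sum.swap)
  finally show ?thesis .
qed

lemma frobenius_norm_nonneg: "0 \<le> frobenius_norm M"
  by (simp add: frobenius_norm_def L2_set_def sum_nonneg)

section \<open>Frobenius norm and orthonormal columns\<close>

lemma frobenius_norm_adjoint: "frobenius_norm (mat_adjoint M) = frobenius_norm M"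
proof -
  have "(frobenius_norm (mat_adjoint M))\<^sup>2 = (\<Sum>j<dim_row M. \<Sum>i<dim_col M. (cmod (M $$ (j, i)))\<^sup>2)"
    by (subst frobenius_norm_sq_sum[of _ "dim_col M" "dim_row M"]) (auto intro!: sum.cong)
  also have "\<dots> = (frobenius_norm M)\<^sup>2"
    by (subst frobenius_norm_sq_sum[of M "dim_row M" "dim_col M"]) (auto intro: sum.swap)
  finally show ?thesis using frobenius_norm_nonneg power2_eq_iff_nonneg by blast
qed

text \<open>Pythagoras for the column space of \<open>Q\<close>: \<open>M - Q * C\<close> is the
  part of \<open>M\<close> orthogonal to that space plus \<open>Q * (mat_adjoint Q * M - C)\<close>.
  In the calculation, every inner product involving \<open>Q * C\<close> becomes one involving
  \<open>C\<close>, and the rest is the expansion of two squares.\<close>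

lemma frobenius_norm_diff_projection:
  assumes Q: "Q \<in> carrier_mat m r" and QQ: "mat_adjoint Q * Q = 1\<^sub>m r"
    and C: "C \<in> carrier_mat r q" and M: "M \<in> carrier_mat m q"
  shows "(frobenius_norm (M - Q * C))\<^sup>2 =
    (frobenius_norm M)\<^sup>2 - (frobenius_norm (mat_adjoint Q * M))\<^sup>2 +
    (frobenius_norm (C - mat_adjoint Q * M))\<^sup>2"
proof -
  let ?D = "mat_adjoint Q * M"
  have D: "?D \<in> carrier_mat r q" and QC: "Q * C \<in> carrier_mat m q" using Q C M by auto
  have "mat_adjoint Q * (Q * C) = C"
    using assoc_mult_mat[of "mat_adjoint Q" r m Q r C q] Q QQ C by simp
  then have e1: "mat_inner (Q * C) (Q * C) = mat_inner C C"
    using mat_inner_mult_left[OF Q C QC] by simp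
  have e2: "mat_inner (Q * C) M = mat_inner C ?D" by (rule mat_inner_mult_left[OF Q C M])
  have e3: "mat_inner M (Q * C) = mat_inner ?D C"
    using e2 mat_inner_cnj[OF QC M] mat_inner_cnj[OF C D] by metis
  have "mat_inner (M - Q * C) (M - Q * C) =
      mat_inner M M - mat_inner ?D ?D + mat_inner (C - ?D) (C - ?D)"
    unfolding mat_inner_diff_self[OF M QC] mat_inner_diff_self[OF C D] e1 e2 e3 by simp
  then show ?thesis
    unfolding mat_inner_self by (metis of_real_add of_real_diff of_real_eq_iff)
qed

lemma frobenius_norm_isometry:
  assumes Q: "Q \<in> carrier_mat m r" and QQ: "mat_adjoint Q * Q = 1\<^sub>m r" and C: "C \<in> carrier_mat r q"
  shows "frobenius_norm (Q * C) = frobenius_norm C"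
proof -
  have "mat_adjoint Q * (Q * C) = C"
    using assoc_mult_mat[of "mat_adjoint Q" r m Q r C q] Q QQ C by simp
  then have "mat_inner (Q * C) (Q * C) = mat_inner C C"
    using mat_inner_mult_left[OF Q C, of "Q * C"] Q C by simp
  then have "(frobenius_norm (Q * C))\<^sup>2 = (frobenius_norm C)\<^sup>2"
    unfolding mat_inner_self by (metis of_real_eq_iff)
  then show ?thesis using frobenius_norm_nonneg power2_eq_iff_nonneg by blast
qed

text \<open>Taking adjoints turns right multiplication by \<open>mat_adjoint V\<close> into left
  multiplication by \<open>V\<close>, which is an isometry.\<close>

lemma frobenius_norm_mult_unitary:
  assumes V: "V \<in> carrier_mat q q" and VV: "mat_adjoint V * V = 1\<^sub>m q" and M: "M \<in> carrier_mat m q"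
  shows "frobenius_norm (M * mat_adjoint V) = frobenius_norm M"
proof -
  have "frobenius_norm (M * mat_adjoint V) = frobenius_norm (mat_adjoint (M * mat_adjoint V))"
    by (simp add: frobenius_norm_adjoint)
  also have "mat_adjoint (M * mat_adjoint V) = V * mat_adjoint M"
    using mat_adjoint_mult[OF M mat_adjoint_carrier[OF V]] by simp
  also have "frobenius_norm \<dots> = frobenius_norm M"
    using frobenius_norm_isometry[OF V VV, of "mat_adjoint M"] M by (auto simp: frobenius_norm_adjoint)
  finally show ?thesis .
qed

text \<open>This is the projection identity at \<open>C = mat_adjoint Q * M\<close>, where the last
  term vanishes and the left side is nonnegative.\<close>

lemma frobenius_norm_bessel:
  assumes Q: "Q \<in> carrier_mat m r" and QQ: "mat_adjoint Q * Q = 1\<^sub>m r" and M: "M \<in> carrier_mat m q"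
  shows "(frobenius_norm (mat_adjoint Q * M))\<^sup>2 \<le> (frobenius_norm M)\<^sup>2"
proof -
  have D: "mat_adjoint Q * M \<in> carrier_mat r q" using Q M by auto
  have "frobenius_norm (mat_adjoint Q * M - mat_adjoint Q * M) = 0"
    unfolding minus_r_inv_mat[OF D] by (simp add: frobenius_norm_def L2_set_def sum.neutral split_beta)
  then show ?thesis
    using frobenius_norm_diff_projection[OF Q QQ D M]
      zero_le_power2[of "frobenius_norm (M - Q * (mat_adjoint Q * M))"] by simp
qed

text \<open>The sum is the diagonal entry of \<open>mat_adjoint U * U\<close> at position
  \<open>r\<close>.\<close>

lemma sum_orthonormal_column:
  assumes U: "U \<in> carrier_mat m p" and UU: "mat_adjoint U * U = 1\<^sub>m p" and r: "r < p"
  shows "(\<Sum>i<m. (cmod (U $$ (i, r)))\<^sup>2) = 1"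
proof -
  have "(mat_adjoint U * U) $$ (r, r) = (\<Sum>i<m. mat_adjoint U $$ (r, i) * U $$ (i, r))"
    using U r by (intro mat_mult_index_sum) auto
  also have "\<dots> = (\<Sum>i<m. complex_of_real ((cmod (U $$ (i, r)))\<^sup>2))"
  proof (rule sum.cong[OF refl])
    fix i assume "i \<in> {..<m}"
    then have "mat_adjoint U $$ (r, i) = cnj (U $$ (i, r))"
      using U r by (intro mat_adjoint_index) auto
    then show "mat_adjoint U $$ (r, i) * U $$ (i, r) = complex_of_real ((cmod (U $$ (i, r)))\<^sup>2)"
      by (simp only: complex_norm_square mult.commute)
  qed
  also have "\<dots> = complex_of_real (\<Sum>i<m. (cmod (U $$ (i, r)))\<^sup>2)" by (rule of_real_sum[symmetric])
  finally show ?thesis unfolding UU using r by (simp del: of_real_sum of_real_power)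
qed

lemma frobenius_norm_orthonormal_columns:
  assumes U: "U \<in> carrier_mat m p" and UU: "mat_adjoint U * U = 1\<^sub>m p"
  shows "(frobenius_norm U)\<^sup>2 = real p"
proof -
  have "(\<Sum>r<p. \<Sum>i<m. (cmod (U $$ (i, r)))\<^sup>2) = (\<Sum>r<p. 1)"
    by (rule sum.cong[OF refl], rule sum_orthonormal_column[OF U UU]) simp
  then show ?thesis unfolding frobenius_norm_sq_sum[OF U] by simp
qed

section \<open>The Eckart--Young theorem\<close>

text \<open>A maximal independent set of columns of \<open>M\<close> has as many elements as the
  rank and spans all columns. Gram-Schmidt followed by normalisation turns it into the columns of
  \<open>Q\<close>, and \<open>C\<close> holds the coordinates of the columns of
  \<open>M\<close>.\<close>

lemma orthonormal_column_factor:
  assumes M: "M \<in> carrier_mat m q"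
  obtains r Q C where "r = vec_space.rank m M" "Q \<in> carrier_mat m r"
    "mat_adjoint Q * Q = 1\<^sub>m r" "C \<in> carrier_mat r q" "M = Q * (C :: complex mat)"
proof -
  interpret cof_vec_space m "TYPE(complex)" .
  have cM: "set (cols M) \<subseteq> carrier_vec m" using M cols_dim[of M] by auto
  obtain W where W: "finite W" "maximal W (\<lambda>T. T \<subseteq> set (cols M) \<and> lin_indpt T)"
    using maximal_exists_superset[of "set (cols M)" "\<lambda>T. T \<subseteq> set (cols M) \<and> lin_indpt T" "{}"]
    by (metis (no_types, lifting) List.finite_set empty_subsetI finite_lin_indpt2 empty_iff finite.emptyI)
  have Wli: "lin_indpt W" and WM: "W \<subseteq> set (cols M)" using W(2) by (auto simp: maximal_def)
  have Wc: "W \<subseteq> carrier_vec m" using WM cM by auto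
  have in_span: "v \<in> span W" if v: "v \<in> set (cols M)" for v
  proof (rule ccontr)
    assume nv: "v \<notin> span W"
    then have vW: "v \<notin> W" using Wc span_mem by auto
    \<comment> \<open>A column outside the span of \<open>W\<close> could be added to
      \<open>W\<close>, against maximality.\<close>
    have "lin_indpt (W \<union> {v})"
      using lin_dep_iff_in_span[of W v] Wc Wli vW v cM nv by blast
    then have "W \<union> {v} = W" using W(2) WM v unfolding maximal_def by blast
    then show False using vW by auto
  qed
  obtain ws where ws: "set ws = W" "distinct ws" using W(1) finite_distinct_list by blast
  define us where "us = gram_schmidt m ws"
  define r where "r = length us"
  have "set ws \<subseteq> carrier_vec m" "\<not> lin_dep (set ws)" using ws Wc Wli by auto
  note gs = gram_schmidt_result[OF this(1) ws(2) this(2) us_def]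
  have "r = card W" unfolding r_def gs(4) ws(1)[symmetric] using distinct_card[OF ws(2)] by simp
  then have rk: "r = vec_space.rank m M" using rank_card_indpt[OF M W(2)] by simp
  have usc: "us ! a \<in> carrier_vec m" if "a < r" for a using that gs(3) by (auto simp: r_def)
  have ex: "\<exists>c. \<forall>i<m. M $$ (i, j) = (\<Sum>a<r. us ! a $ i * c a)" if j: "j < q" for j
  proof -
    have "col M j \<in> set (cols M)" using j M by (auto simp: cols_def)
    then have "col M j \<in> span_list us"
      using in_span gs(1) ws(1) span_list_as_span[OF gs(3)] by auto
    then obtain c where c: "col M j = lincomb_list c us" by (auto simp: span_list_def)
    have "M $$ (i, j) = (\<Sum>a<r. us ! a $ i * c a)" if i: "i < m" for i
    proof -
      have "M $$ (i, j) = col M j $ i" using i j M by auto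
      also have "\<dots> = (mat_of_cols m us *\<^sub>v vec r c) $ i"
        unfolding c r_def using gs(3) by (subst lincomb_list_as_mat_mult) auto
      also have "\<dots> = (\<Sum>a<r. mat_of_cols m us $$ (i, a) * vec r c $ a)"
        by (rule mat_vec_index_sum[of _ m]) (use i in \<open>auto simp: r_def\<close>)
      also have "\<dots> = (\<Sum>a<r. us ! a $ i * c a)"
        by (rule sum.cong[OF refl]) (use i in \<open>auto simp: r_def mat_of_cols_def\<close>)
      finally show ?thesis .
    qed
    then show ?thesis by blast
  qed
  then obtain c where c: "\<And>j i. j < q \<Longrightarrow> i < m \<Longrightarrow> M $$ (i, j) = (\<Sum>a<r. us ! a $ i * c j a)"
    by metis
  \<comment> \<open>Gram-Schmidt yields nonzero orthogonal vectors that need not have length one.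
    \<open>Q\<close> divides by the lengths \<open>nu a\<close>, and \<open>C\<close> multiplies the
    coordinates by them in compensation.\<close>
  define nu where "nu a = sqrt (\<Sum>i<m. (cmod (us ! a $ i))\<^sup>2)" for a
  have ip: "us ! b \<bullet>c us ! a = (\<Sum>i<m. cnj (us ! a $ i) * us ! b $ i)" if "a < r" "b < r" for a b
    unfolding scalar_prod_def using usc[OF that(1)] usc[OF that(2)]
    by (auto simp: lessThan_atLeast0 mult.commute simp del: atLeast0LessThan intro!: sum.cong)
  have nu2: "of_real (nu a) * of_real (nu a) = us ! a \<bullet>c us ! a" if "a < r" for a
  proof -
    have "complex_of_real (nu a) * of_real (nu a) = of_real ((nu a)\<^sup>2)" by (simp add: power2_eq_square)
    also have "(nu a)\<^sup>2 = (\<Sum>i<m. (cmod (us ! a $ i))\<^sup>2)" by (simp add: nu_def sum_nonneg)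
    also have "complex_of_real \<dots> = (\<Sum>i<m. us ! a $ i * cnj (us ! a $ i))"
      unfolding of_real_sum complex_norm_square ..
    also have "\<dots> = us ! a \<bullet>c us ! a" unfolding ip[OF that that] by (simp only: mult.commute)
    finally show ?thesis .
  qed
  have nu0: "nu a \<noteq> 0" if "a < r" for a
    using nu2[OF that] corthogonalD[OF gs(2), of a a] that by (auto simp: r_def)
  define Q where "Q = mat m r (\<lambda>(i, a). us ! a $ i / of_real (nu a))"
  define C where "C = mat r q (\<lambda>(a, j). of_real (nu a) * c j a)"
  have Q: "Q \<in> carrier_mat m r" and C: "C \<in> carrier_mat r q" by (auto simp: Q_def C_def)
  have QC: "M = Q * C"
  proof (rule eq_matI)
    fix i j assume "i < dim_row (Q * C)" "j < dim_col (Q * C)"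
    then have ij: "i < m" "j < q" using Q C by auto
    show "M $$ (i, j) = (Q * C) $$ (i, j)"
      unfolding mat_mult_index_sum[OF Q C ij] c[OF ij(2,1)]
      by (rule sum.cong[OF refl]) (use ij nu0 in \<open>auto simp: Q_def C_def\<close>)
  qed (use M Q C in auto)
  have QQ: "mat_adjoint Q * Q = 1\<^sub>m r"
  proof (rule eq_matI)
    fix a b assume "a < dim_row (1\<^sub>m r)" "b < dim_col (1\<^sub>m r)"
    then have ab: "a < r" "b < r" by auto
    have "(mat_adjoint Q * Q) $$ (a, b) = (\<Sum>i<m. mat_adjoint Q $$ (a, i) * Q $$ (i, b))"
      by (rule mat_mult_index_sum[OF mat_adjoint_carrier[OF Q] Q ab])
    also have "\<dots> = (\<Sum>i<m. (cnj (us ! a $ i) * us ! b $ i) / (of_real (nu a) * of_real (nu b)))"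
    proof (rule sum.cong[OF refl])
      fix i assume "i \<in> {..<m}"
      then show "mat_adjoint Q $$ (a, i) * Q $$ (i, b) =
          (cnj (us ! a $ i) * us ! b $ i) / (of_real (nu a) * of_real (nu b))"
        using mat_adjoint_index[of a Q i] ab Q by (auto simp: Q_def)
    qed
    also have "\<dots> = (us ! b \<bullet>c us ! a) / (of_real (nu a) * of_real (nu b))"
      unfolding ip[OF ab] sum_divide_distrib ..
    also have "\<dots> = 1\<^sub>m r $$ (a, b)"
    proof (cases "a = b")
      case True
      then show ?thesis using nu2[OF ab(1)] nu0[OF ab(1)] ab by auto
    next
      case False
      then show ?thesis using corthogonalD[OF gs(2), of b a] ab by (auto simp: r_def)
    qed
    finally show "(mat_adjoint Q * Q) $$ (a, b) = 1\<^sub>m r $$ (a, b)" .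
  qed (use Q in auto)
  show thesis using that[OF rk Q QQ C QC] .
qed

text \<open>The product is a sum of \<open>n\<close> matrices, each a column of \<open>L\<close>
  times a row of \<open>R\<close>. Rank is subadditive and each such matrix has rank at most 1;
  \<open>P t\<close> is the partial sum of the first \<open>t\<close> of them.\<close>

lemma rank_mult_le:
  assumes L: "L \<in> carrier_mat m n" and R: "R \<in> carrier_mat n q"
  shows "vec_space.rank m (L * (R :: complex mat)) \<le> n"
proof -
  interpret vec_space "TYPE(complex)" m .
  define P where "P t = mat m q (\<lambda>(i, j). \<Sum>l<t. L $$ (i, l) * R $$ (l, j))" for t
  have "rank (P t) \<le> t" for t
  proof (induction t)
    case 0
    have "P 0 = 0\<^sub>m m q" by (rule eq_matI) (auto simp: P_def)
    then show ?case using rank_0I[of q] by simp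
  next
    case (Suc t)
    define T where "T = mat m q (\<lambda>(i, j). L $$ (i, t) * R $$ (t, j))"
    have T: "T \<in> carrier_mat m q" and P: "P t \<in> carrier_mat m q" by (auto simp: T_def P_def)
    have "rank T \<le> 1"
      by (rule rank_le_1_product_entries[OF T, of "\<lambda>i. L $$ (i, t)" "\<lambda>j. R $$ (t, j)"])
        (auto simp: T_def)
    moreover have "P (Suc t) = P t + T" by (rule eq_matI) (auto simp: P_def T_def)
    ultimately show ?case using rank_subadditive[OF P T] Suc by simp
  qed
  moreover have "L * R = P n"
    by (rule eq_matI) (use L R in \<open>auto simp: P_def mat_mult_index_sum[OF L R] simp del: index_mult_mat(1)\<close>)
  ultimately show ?thesis by simp
qed

section \<open>Frobenius norms in terms of singular values\<close>

lemma frobenius_norm_mult_diagonal: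
  assumes G: "G \<in> carrier_mat m p" and D: "D \<in> carrier_mat p q" "diagonal_mat D" and pq: "p \<le> q"
  shows "(frobenius_norm (G * map_mat complex_of_real D))\<^sup>2 =
    (\<Sum>r<p. (D $$ (r, r))\<^sup>2 * (\<Sum>i<m. (cmod (G $$ (i, r)))\<^sup>2))"
proof -
  let ?D = "map_mat complex_of_real D"
  have D': "?D \<in> carrier_mat p q" using D by auto
  \<comment> \<open>Multiplication by the diagonal matrix scales column \<open>j\<close> of
    \<open>G\<close> and, as \<open>D\<close> may be wider than tall, appends zero columns from
    \<open>p\<close> on.\<close>
  have entry: "(G * ?D) $$ (i, j) = (if j < p then G $$ (i, j) * of_real (D $$ (j, j)) else 0)"
    if ij: "i < m" "j < q" for i j
  proof -
    have "(G * ?D) $$ (i, j) = (\<Sum>l<p. G $$ (i, l) * ?D $$ (l, j))"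
      by (rule mat_mult_index_sum[OF G D' ij])
    also have "\<dots> = (\<Sum>l<p. if l = j then G $$ (i, j) * of_real (D $$ (j, j)) else 0)"
      by (rule sum.cong[OF refl]) (use D ij in \<open>auto simp: diagonal_mat_def\<close>)
    finally show ?thesis by (simp add: sum.delta)
  qed
  have "(frobenius_norm (G * ?D))\<^sup>2 = (\<Sum>j<q. \<Sum>i<m. (cmod ((G * ?D) $$ (i, j)))\<^sup>2)"
    using frobenius_norm_sq_sum[of "G * ?D" m q] G D' by auto
  also have "\<dots> = (\<Sum>j<q. if j < p then (D $$ (j, j))\<^sup>2 * (\<Sum>i<m. (cmod (G $$ (i, j)))\<^sup>2) else 0)"
    by (rule sum.cong[OF refl])
      (auto simp: entry norm_mult power_mult_distrib sum_distrib_left mult.commute simp del: index_mult_mat)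
  also have "\<dots> = (\<Sum>j<p. (D $$ (j, j))\<^sup>2 * (\<Sum>i<m. (cmod (G $$ (i, j)))\<^sup>2))"
    using pq by (intro sum.mono_neutral_cong_right) auto
  finally show ?thesis .
qed

text \<open>The factor \<open>mat_adjoint V\<close> preserves the norm and the columns of
  \<open>U\<close> have norm 1. No sign is imposed on the diagonal of \<open>D\<close>, so
  differences of singular value matrices are covered as well.\<close>

lemma frobenius_norm_svd:
  assumes U: "U \<in> carrier_mat m p" "mat_adjoint U * U = 1\<^sub>m p"
    and V: "V \<in> carrier_mat q q" "mat_adjoint V * V = 1\<^sub>m q"
    and D: "D \<in> carrier_mat p q" "diagonal_mat D" and pq: "p \<le> q"
  shows "(frobenius_norm (U * map_mat complex_of_real D * mat_adjoint V))\<^sup>2 = (\<Sum>r<p. (D $$ (r, r))\<^sup>2)"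
proof -
  have "U * map_mat complex_of_real D \<in> carrier_mat m q" using U D by auto
  from frobenius_norm_mult_unitary[OF V this] frobenius_norm_mult_diagonal[OF U(1) D pq]
  show ?thesis by (simp add: sum_orthonormal_column[OF U])
qed

text \<open>An exchange argument: some threshold \<open>t\<close> separates the leading values from
  the trailing ones. Weight on trailing indices earns at most \<open>t\<close> per unit, and since
  the total is at most \<open>n\<close> it fits into the gaps \<open>1 - c r\<close> at the leading
  indices, where each unit earns at least \<open>t\<close>.\<close>

lemma sum_weighted_le_leading:
  fixes s c :: "nat \<Rightarrow> real"
  assumes s: "\<And>r. r < p \<Longrightarrow> 0 \<le> s r" "\<And>a b. a < n \<Longrightarrow> n \<le> b \<Longrightarrow> b < p \<Longrightarrow> s b \<le> s a"
    and c: "\<And>r. r < p \<Longrightarrow> 0 \<le> c r" "\<And>r. r < p \<Longrightarrow> c r \<le> 1" "(\<Sum>r<p. c r) \<le> real n"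
    and np: "n \<le> p"
  shows "(\<Sum>r<p. s r * c r) \<le> (\<Sum>r<n. s r)"
proof -
  obtain t where t: "0 \<le> t" "\<And>a. a < n \<Longrightarrow> t \<le> s a" "\<And>b. n \<le> b \<Longrightarrow> b < p \<Longrightarrow> s b \<le> t"
  \<comment> \<open>The threshold is the largest trailing value; when there is no trailing index, 0
    separates.\<close>
  proof (cases "n < p")
    case True
    define t where "t = Max (s ` {n..<p})"
    have "t \<in> s ` {n..<p}" unfolding t_def using True by (intro Max_in) auto
    then obtain b where b: "n \<le> b" "b < p" "t = s b" by auto
    show thesis
    proof (rule that[of t])
      show "s b' \<le> t" if "n \<le> b'" "b' < p" for b' unfolding t_def using that by (intro Max_ge) auto
    qed (use b s in auto)
  qed (use s np that[of 0] in auto)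
  have split: "(\<Sum>r<p. f r) = (\<Sum>r<n. f r) + (\<Sum>r\<in>{n..<p}. f r)" for f :: "nat \<Rightarrow> real"
    using np by (metis lessThan_atLeast0 sum.atLeastLessThan_concat le0)
  have "(\<Sum>r\<in>{n..<p}. s r * c r) \<le> (\<Sum>r\<in>{n..<p}. t * c r)"
    using t c by (intro sum_mono mult_right_mono) auto
  also have "\<dots> = t * (\<Sum>r\<in>{n..<p}. c r)" by (simp add: sum_distrib_left)
  \<comment> \<open>The bound on the total weight enters here, and \<open>t\<close> must be
    nonnegative for it.\<close>
  also have "\<dots> \<le> t * (real n - (\<Sum>r<n. c r))"
    using split[of c] c(3) t(1) by (intro mult_left_mono) auto
  also have "\<dots> = (\<Sum>r<n. t * (1 - c r))" by (simp add: sum_distrib_left[symmetric] sum_subtractf)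
  also have "\<dots> \<le> (\<Sum>r<n. s r * (1 - c r))"
    using t c np by (intro sum_mono mult_right_mono) auto
  also have "\<dots> = (\<Sum>r<n. s r) - (\<Sum>r<n. s r * c r)"
    by (simp add: right_diff_distrib sum_subtractf)
  finally show ?thesis using split[of "\<lambda>r. s r * c r"] by simp
qed

text \<open>It keeps the shape of \<open>D\<close>, so that the truncation uses the same factors
  \<open>U\<close> and \<open>V\<close>. Clearing whole rows of a diagonal matrix removes just its
  trailing diagonal entries.\<close>

definition leading_part :: "nat \<Rightarrow> real mat \<Rightarrow> real mat" where
  "leading_part n D = mat (dim_row D) (dim_col D) (\<lambda>(a, b). if a < n then D $$ (a, b) else 0)"

lemma frobenius_norm_minus_commute:
  assumes "X \<in> carrier_mat a b" "Y \<in> carrier_mat a b"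
  shows "frobenius_norm (X - Y) = frobenius_norm (Y - X)"
proof -
  have "cmod ((X - Y) $$ p) = cmod ((Y - X) $$ p)" if "p \<in> {..<a} \<times> {..<b}" for p
    using that assms by (auto simp: norm_minus_commute)
  then show ?thesis using assms unfolding frobenius_norm_def L2_set_def by (auto cong: sum.cong)
qed

text \<open>The truncation misses exactly the trailing squared singular values. A competitor misses
  at least as much, because the column space of rank at most \<open>n\<close> captures no more of
  \<open>M\<close> than the sum of the \<open>n\<close> leading ones.\<close>

lemma eckart_young_frobenius:
  assumes svd: "svd_split m q n M U S V" and nmq: "n \<le> m" "n \<le> q"
    and M': "M' \<in> carrier_mat m q" and rk: "vec_space.rank m M' \<le> n"
  shows "(frobenius_norm (U * map_mat complex_of_real (leading_part n S) * mat_adjoint V - M))\<^sup>2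
    \<le> (frobenius_norm (M' - M))\<^sup>2"
proof -
  define p where "p = min m q"
  have p: "n \<le> p" "p \<le> q" using nmq by (auto simp: p_def)
  have U: "U \<in> carrier_mat m p" and UU: "mat_adjoint U * U = 1\<^sub>m p"
    and V: "V \<in> carrier_mat q q" and VV: "mat_adjoint V * V = 1\<^sub>m q"
    and S: "S \<in> carrier_mat p q" and Sd: "diagonal_mat S"
    and S0: "\<And>r. r < p \<Longrightarrow> 0 \<le> S $$ (r, r)"
    and Sle: "\<And>a b. a < n \<Longrightarrow> n \<le> b \<Longrightarrow> b < p \<Longrightarrow> S $$ (b, b) \<le> S $$ (a, a)"
    and MU: "M = U * map_mat complex_of_real S * mat_adjoint V"
    using svd unfolding svd_split_def p_def by auto
  let ?S = "map_mat complex_of_real S" and ?L = "map_mat complex_of_real (leading_part n S)"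
  define s where "s r = (S $$ (r, r))\<^sup>2" for r
  have S': "?S \<in> carrier_mat p q" and L': "?L \<in> carrier_mat p q" and VH: "mat_adjoint V \<in> carrier_mat q q"
    using S V by (auto simp: leading_part_def)
  have US: "U * ?S \<in> carrier_mat m q" and UL: "U * ?L \<in> carrier_mat m q" using U S' L' by auto
  have M: "M \<in> carrier_mat m q" unfolding MU using US VH by auto
  have split: "(\<Sum>r<p. f r) = (\<Sum>r<n. f r) + (\<Sum>r\<in>{n..<p}. f r)" for f :: "nat \<Rightarrow> real"
    using p(1) by (metis lessThan_atLeast0 sum.atLeastLessThan_concat le0)
  \<comment> \<open>The truncation error again has orthonormal outer factors around a diagonal
    matrix, whose entries are 0 in the leading part and minus the singular values after it.\<close>
  have "U * ?L * mat_adjoint V - M = U * map_mat complex_of_real (leading_part n S - S) * mat_adjoint V"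
  proof -
    have "map_mat complex_of_real (leading_part n S - S) = ?L - ?S"
      by (rule eq_matI) (auto simp: leading_part_def)
    then have "U * map_mat complex_of_real (leading_part n S - S) = U * ?L - U * ?S"
      using mult_minus_distrib_mat[OF U L' S'] by simp
    then show ?thesis unfolding MU using minus_mult_distrib_mat[OF UL US VH] by simp
  qed
  moreover have "leading_part n S - S \<in> carrier_mat p q" "diagonal_mat (leading_part n S - S)"
    using S Sd by (auto simp: leading_part_def diagonal_mat_def)
  ultimately have "(frobenius_norm (U * ?L * mat_adjoint V - M))\<^sup>2 =
      (\<Sum>r<p. ((leading_part n S - S) $$ (r, r))\<^sup>2)"
    using frobenius_norm_svd[OF U UU V VV _ _ p(2)] by simp
  also have "\<dots> = (\<Sum>r<p. if r < n then 0 else s r)"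
    by (rule sum.cong[OF refl]) (use S p in \<open>auto simp: leading_part_def s_def\<close>)
  also have "\<dots> = (\<Sum>r\<in>{n..<p}. s r)" unfolding split by simp
  finally have trunc: "(frobenius_norm (U * ?L * mat_adjoint V - M))\<^sup>2 = (\<Sum>r\<in>{n..<p}. s r)" .

  obtain r Q C where r: "r = vec_space.rank m M'" and Q: "Q \<in> carrier_mat m r"
    and QQ: "mat_adjoint Q * Q = 1\<^sub>m r" and C: "C \<in> carrier_mat r q" and QC: "M' = Q * C"
    using orthonormal_column_factor[OF M'] .
  define G where "G = mat_adjoint Q * U"
  have QH: "mat_adjoint Q \<in> carrier_mat r m" and G: "G \<in> carrier_mat r p"
    using Q U by (auto simp: G_def)
  \<comment> \<open>\<open>c l\<close> is the squared length of the projection of column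
    \<open>l\<close> of \<open>U\<close> onto the column space of \<open>Q\<close>; these are the
    weights of the exchange argument.\<close>
  define c where "c l = (\<Sum>i<r. (cmod (G $$ (i, l)))\<^sup>2)" for l
  have "mat_adjoint Q * M = G * ?S * mat_adjoint V"
    unfolding MU G_def using assoc_mult_mat[OF QH US VH] assoc_mult_mat[OF QH U S'] by simp
  then have "(frobenius_norm (mat_adjoint Q * M))\<^sup>2 = (\<Sum>l<p. s l * c l)"
    using frobenius_norm_mult_unitary[OF V VV, of "G * ?S" r] G S'
      frobenius_norm_mult_diagonal[OF G S Sd p(2)] by (simp add: s_def c_def)
  also have "\<dots> \<le> (\<Sum>l<n. s l)"
  proof (rule sum_weighted_le_leading)
    show "s b \<le> s a" if "a < n" "n \<le> b" "b < p" for a b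
      using Sle[OF that] S0[OF that(3)] by (simp add: s_def power_mono)
    show "c l \<le> 1" if l: "l < p" for l
    proof -
      \<comment> \<open>\<open>e\<close> is the standard basis vector number \<open>l\<close> as a
        one-column matrix. It selects a column of \<open>U\<close> of norm 1, to which Bessel's
        inequality for \<open>Q\<close> applies.\<close>
      define e where "e = mat p 1 (\<lambda>(i, j). if i = l then 1 else 0 :: complex)"
      have e: "e \<in> carrier_mat p 1" by (simp add: e_def)
      have Ue: "U * e \<in> carrier_mat m 1" using U e by auto
      have "(G * e) $$ (i, 0) = G $$ (i, l)" if "i < r" for i
      proof -
        have "(G * e) $$ (i, 0) = (\<Sum>j<p. if j = l then G $$ (i, l) else 0)"
          using mat_mult_index_sum[OF G e, of i 0] that
          by (simp add: e_def if_distrib cong: if_cong del: index_mult_mat(1))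
        then show ?thesis using l by simp
      qed
      then have "c l = (frobenius_norm (G * e))\<^sup>2"
        using frobenius_norm_sq_sum[of "G * e" r 1] G e by (simp add: c_def del: index_mult_mat(1))
      also have "G * e = mat_adjoint Q * (U * e)"
        unfolding G_def by (rule assoc_mult_mat[OF QH U e])
      also have "(frobenius_norm \<dots>)\<^sup>2 \<le> (frobenius_norm (U * e))\<^sup>2"
        by (rule frobenius_norm_bessel[OF Q QQ Ue])
      also have "\<dots> = (frobenius_norm e)\<^sup>2" using frobenius_norm_isometry[OF U UU e] by simp
      also have "\<dots> = (\<Sum>i<p. if i = l then 1 else 0)"
        unfolding frobenius_norm_sq_sum[OF e] by (simp del: sum.delta, rule sum.cong, auto simp: e_def)
      also have "\<dots> = 1" using l by simp
      finally show ?thesis .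
    qed
    \<comment> \<open>For the total weight the roles are swapped: after taking the adjoint, Bessel's
      inequality for \<open>U\<close> bounds it by the squared norm of \<open>Q\<close>, which is
      its number of columns.\<close>
    have "(\<Sum>l<p. c l) = (frobenius_norm G)\<^sup>2"
      unfolding c_def frobenius_norm_sq_sum[OF G] ..
    also have "\<dots> = (frobenius_norm (mat_adjoint U * Q))\<^sup>2"
      using frobenius_norm_adjoint[of G] mat_adjoint_mult[OF QH U] by (simp add: G_def)
    also have "\<dots> \<le> (frobenius_norm Q)\<^sup>2" by (rule frobenius_norm_bessel[OF U UU Q])
    also have "\<dots> = real r" by (rule frobenius_norm_orthonormal_columns[OF Q QQ])
    finally show "(\<Sum>l<p. c l) \<le> real n" using rk r by simp
  qed (use p in \<open>auto simp: s_def c_def sum_nonneg\<close>)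
  finally have "(frobenius_norm (mat_adjoint Q * M))\<^sup>2 \<le> (\<Sum>l<n. s l)" .
  moreover have "(frobenius_norm M)\<^sup>2 = (\<Sum>l<p. s l)"
    unfolding MU frobenius_norm_svd[OF U UU V VV S Sd p(2)] s_def ..
  \<comment> \<open>Pythagoras with its last, nonnegative term dropped.\<close>
  moreover have "(frobenius_norm (M' - M))\<^sup>2 \<ge> (frobenius_norm M)\<^sup>2 - (frobenius_norm (mat_adjoint Q * M))\<^sup>2"
    using frobenius_norm_minus_commute[OF M' M] frobenius_norm_diff_projection[OF Q QQ C M]
    by (simp add: QC)
  ultimately show ?thesis unfolding trunc using split[of s] by simp
qed

section \<open>Block rows\<close>

text \<open>Serves horizontal concatenation: with \<open>n\<close> columns per block, the flat
  column index \<open>r * n + b\<close> means column \<open>b\<close> of block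
  \<open>r\<close>.\<close>

lemma nth_concat_uniform:
  assumes "\<And>xs. xs \<in> set xss \<Longrightarrow> length xs = n" "r < length xss" "b < n"
  shows "concat xss ! (r * n + b) = xss ! r ! b"
  using assms
proof (induction xss arbitrary: r)
  case (Cons xs xss)
  then show ?case by (cases r) (auto simp: nth_append)
qed simp

lemma length_concat_uniform:
  assumes "\<And>xs. xs \<in> set xss \<Longrightarrow> length xs = n"
  shows "length (concat xss) = length xss * n"
  using assms by (induction xss) auto

lemma length_cols_coeffs:
  assumes "A \<in> carrier_mat m n" "\<forall>s\<in>{1..k}. B s \<in> carrier_mat m n"
    and "xs \<in> set (map cols (A # map B [1..<Suc k]))"
  shows "length xs = n"
proof -
  obtain C where C: "C \<in> set (A # map B [1..<Suc k])" "xs = cols C" using assms(3) by auto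
  have "C \<in> carrier_mat m n"
    using C(1) assms(1,2) by (auto simp: atLeastLessThanSuc_atLeastAtMost simp del: upt_Suc)
  then show ?thesis using C(2) by simp
qed

lemma coeff_row_carrier:
  assumes "A \<in> carrier_mat m n" "\<forall>s\<in>{1..k}. B s \<in> carrier_mat m n"
  shows "coeff_row k m A B \<in> carrier_mat m ((k + 1) * n)"
proof -
  have "length (concat (map cols (A # map B [1..<Suc k]))) = (k + 1) * n"
    by (subst length_concat_uniform[of _ n]) (use length_cols_coeffs[OF assms] in auto)
  then show ?thesis unfolding coeff_row_def hconcat_def by (metis mat_of_cols_carrier(1))
qed

text \<open>With \<open>A\<close> at position 0 of the list, the 1-based family \<open>B\<close>
  lands so that \<open>B r\<close> is at position \<open>r\<close>; the 0-based block number is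
  therefore also the index of \<open>B\<close>.\<close>

lemma coeff_row_index:
  assumes A: "A \<in> carrier_mat m n" and B: "\<forall>s\<in>{1..k}. B s \<in> carrier_mat m n"
    and a: "a < m" and r: "r \<le> k" and b: "b < n"
  shows "coeff_row k m A B $$ (a, r * n + b) = (if r = 0 then A else B r) $$ (a, b)"
proof -
  let ?Ms = "A # map B [1..<Suc k]"
  have len: "length xs = n" if "xs \<in> set (map cols ?Ms)" for xs
    by (rule length_cols_coeffs[OF A B that])
  have lt: "r * n + b < (k + 1) * n"
  proof -
    have "r * n + b < (r + 1) * n" using b by simp
    also have "\<dots> \<le> (k + 1) * n" using r by (intro mult_right_mono) auto
    finally show ?thesis .
  qed
  have nth: "?Ms ! r = (if r = 0 then A else B r)" using r by (auto simp: nth_Cons' simp del: upt_Suc)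
  have M: "?Ms ! r \<in> carrier_mat m n" unfolding nth using A B r by auto
  have "length (concat (map cols ?Ms)) = (k + 1) * n"
    by (subst length_concat_uniform[OF len]) auto
  then have "coeff_row k m A B $$ (a, r * n + b) = concat (map cols ?Ms) ! (r * n + b) $ a"
    unfolding coeff_row_def hconcat_def mat_of_cols_def using a lt by simp
  also have "\<dots> = cols (?Ms ! r) ! b $ a"
    using r by (subst nth_concat_uniform[OF len _ b]) (auto simp del: upt_Suc simp: nth_Cons' )
  also have "\<dots> = (?Ms ! r) $$ (a, b)" using M a b by auto
  finally show ?thesis unfolding nth .
qed

lemma block_index_cases:
  assumes "j < K * (n :: nat)"
  obtains r b where "r < K" "b < n" "j = r * n + b"
proof (rule that)
  have "0 < n" using assms by (cases n) auto
  then show "j mod n < n" by simp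
  show "j div n < K" using assms by (simp add: less_mult_imp_div_less)
  show "j = j div n * n + j mod n" by simp
qed

lemma block_index_less:
  assumes "r < K" "b < n"
  shows "r * n + b < K * (n :: nat)"
proof -
  have "r * n + b < Suc r * n" using assms by simp
  also have "\<dots> \<le> K * n" using assms by (intro mult_right_mono) auto
  finally show ?thesis .
qed

lemma coeff_row_eqI:
  assumes A: "A \<in> carrier_mat m n" and B: "\<forall>s\<in>{1..k}. B s \<in> carrier_mat m n"
    and M: "M \<in> carrier_mat m ((k + 1) * n)"
    and eq: "\<And>a r b. a < m \<Longrightarrow> r \<le> k \<Longrightarrow> b < n \<Longrightarrow>
      (if r = 0 then A else B r) $$ (a, b) = M $$ (a, r * n + b)"
  shows "coeff_row k m A B = M"
proof (rule eq_matI)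
  fix a j assume "a < dim_row M" "j < dim_col M"
  then have a: "a < m" and "j < (k + 1) * n" using M by auto
  then obtain r b where "r < k + 1" "b < n" "j = r * n + b" using block_index_cases by blast
  then show "coeff_row k m A B $$ (a, j) = M $$ (a, j)"
    using coeff_row_index[OF A B a] eq[OF a] by simp
qed (use M coeff_row_carrier[OF A B] in auto)

lemma coeff_row_diff:
  assumes A: "A \<in> carrier_mat m n" and B: "\<forall>s\<in>{1..k}. B s \<in> carrier_mat m n"
    and A': "A' \<in> carrier_mat m n" and B': "\<forall>s\<in>{1..k}. B' s \<in> carrier_mat m n"
  shows "coeff_row k m (A' - A) (\<lambda>s. B' s - B s) = coeff_row k m A' B' - coeff_row k m A B"
proof (rule coeff_row_eqI)
  note c = coeff_row_carrier[OF A B] coeff_row_carrier[OF A' B']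
  fix a r b assume arb: "a < m" "r \<le> k" "b < n"
  have "(if r = 0 then A else B r) \<in> carrier_mat m n" using A B arb by auto
  moreover have "r * n + b < (k + 1) * n" using arb block_index_less[of r "k + 1" b n] by simp
  ultimately show "(if r = 0 then A' - A else B' r - B r) $$ (a, b) =
      (coeff_row k m A' B' - coeff_row k m A B) $$ (a, r * n + b)"
    using arb c coeff_row_index[OF A B arb] coeff_row_index[OF A' B' arb] by auto
qed (use A B coeff_row_carrier[OF A B] in \<open>auto intro: minus_carrier_mat\<close>)

section \<open>Blocks of \<open>V\<close> and the truncated SVD as a block row\<close>

lemma block_r1_carrier [simp]: "block_r1 n V r \<in> carrier_mat n n"
  by (simp add: block_r1_def)

lemma block_r1_dim [simp]: "dim_row (block_r1 n V r) = n" "dim_col (block_r1 n V r) = n"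
  by (simp_all add: block_r1_def)

text \<open>The blocks \<open>block_r1 n V r\<close>, stacked for \<open>r\<close> from 1 to
  \<open>k + 1\<close>, are the first \<open>n\<close> columns of \<open>V\<close>, so their
  adjoints side by side form the adjoint of that tall matrix. Since \<open>block_r1\<close> counts
  from 1, block \<open>r\<close> of the row comes from \<open>block_r1 n V (r + 1)\<close>.\<close>

lemma coeff_row_mult_blocks:
  assumes L: "L \<in> carrier_mat m n"
    and V: "V \<in> carrier_mat ((k + 1) * n) ((k + 1) * n)"
  shows "coeff_row k m (L * mat_adjoint (block_r1 n V 1)) (\<lambda>s. L * mat_adjoint (block_r1 n V (s + 1)))
    = L * mat_adjoint (mat ((k + 1) * n) n (\<lambda>(a, b). V $$ (a, b)))" (is "_ = L * mat_adjoint ?V")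
proof (rule coeff_row_eqI)
  have V': "mat_adjoint ?V \<in> carrier_mat n ((k + 1) * n)" by (intro mat_adjoint_carrier mat_carrier)
  show "L * mat_adjoint ?V \<in> carrier_mat m ((k + 1) * n)" using L V' by auto
  fix a r b assume arb: "a < m" "r \<le> k" "b < n"
  have lt: "r * n + b < (k + 1) * n" using arb block_index_less[of r "k + 1" b n] by simp
  have "(L * mat_adjoint (block_r1 n V (r + 1))) $$ (a, b) =
      (\<Sum>l<n. L $$ (a, l) * mat_adjoint (block_r1 n V (r + 1)) $$ (l, b))"
    by (rule mat_mult_index_sum[OF L mat_adjoint_carrier[OF block_r1_carrier] arb(1,3)])
  also have "\<dots> = (\<Sum>l<n. L $$ (a, l) * mat_adjoint ?V $$ (l, r * n + b))"
  proof (rule sum.cong[OF refl])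
    fix l assume "l \<in> {..<n}"
    then show "L $$ (a, l) * mat_adjoint (block_r1 n V (r + 1)) $$ (l, b) =
        L $$ (a, l) * mat_adjoint ?V $$ (l, r * n + b)"
      using mat_adjoint_index[of l "block_r1 n V (r + 1)" b] mat_adjoint_index[of l ?V "r * n + b"] arb lt
      by (simp add: block_r1_def)
  qed
  also have "\<dots> = (L * mat_adjoint ?V) $$ (a, r * n + b)"
    by (rule mat_mult_index_sum[OF L V' arb(1) lt, symmetric])
  finally show "(if r = 0 then L * mat_adjoint (block_r1 n V 1)
      else L * mat_adjoint (block_r1 n V (r + 1))) $$ (a, b) = (L * mat_adjoint ?V) $$ (a, r * n + b)"
    by (cases "r = 0") simp_all
qed (use L in \<open>auto intro!: mult_carrier_mat mat_adjoint_carrier\<close>)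

text \<open>The columns of \<open>U * leading_part n S\<close> from \<open>n\<close> on vanish, so
  only the first \<open>n\<close> columns of \<open>V\<close> contribute. \<open>L\<close> consists
  of the first \<open>n\<close> columns of that product.\<close>

lemma truncated_svd_factor:
  assumes U: "U \<in> carrier_mat m p" and S: "S \<in> carrier_mat p q" and Sd: "diagonal_mat S"
    and V: "V \<in> carrier_mat q q" and nq: "n \<le> q"
  obtains L where "L \<in> carrier_mat m n"
    "U * map_mat complex_of_real (leading_part n S) * mat_adjoint V
      = L * mat_adjoint (mat q n (\<lambda>(a, b). V $$ (a, b)))"
proof -
  let ?X = "U * map_mat complex_of_real (leading_part n S)"
  let ?V = "mat q n (\<lambda>(a, b). V $$ (a, b))"
  have S': "map_mat complex_of_real (leading_part n S) \<in> carrier_mat p q"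
    using S by (auto simp: leading_part_def)
  have X: "?X \<in> carrier_mat m q" using U S' by auto
  have VH: "mat_adjoint V \<in> carrier_mat q q" using V by auto
  have V': "?V \<in> carrier_mat q n" by simp
  define L where "L = mat m n (\<lambda>(a, b). ?X $$ (a, b))"
  have L: "L \<in> carrier_mat m n" by (simp add: L_def)
  have X0: "?X $$ (a, l) = 0" if "a < m" "n \<le> l" "l < q" for a l
    unfolding mat_mult_index_sum[OF U S' that(1,3)]
    by (rule sum.neutral) (use S Sd that in \<open>auto simp: leading_part_def diagonal_mat_def\<close>)
  have "?X * mat_adjoint V = L * mat_adjoint ?V"
  proof (rule eq_matI)
    fix a j assume "a < dim_row (L * mat_adjoint ?V)" "j < dim_col (L * mat_adjoint ?V)"
    then have aj: "a < m" "j < q" using L by auto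
    have "(?X * mat_adjoint V) $$ (a, j) = (\<Sum>l<q. ?X $$ (a, l) * mat_adjoint V $$ (l, j))"
      by (rule mat_mult_index_sum[OF X VH aj])
    also have "\<dots> = (\<Sum>l<n. ?X $$ (a, l) * mat_adjoint V $$ (l, j))"
      by (rule sum.mono_neutral_right) (use nq X0[OF aj(1)] in auto)
    also have "\<dots> = (\<Sum>l<n. L $$ (a, l) * mat_adjoint ?V $$ (l, j))"
    proof (rule sum.cong[OF refl])
      fix l assume "l \<in> {..<n}"
      then show "?X $$ (a, l) * mat_adjoint V $$ (l, j) = L $$ (a, l) * mat_adjoint ?V $$ (l, j)"
        using mat_adjoint_index[of l V j] mat_adjoint_index[of l ?V j] V aj nq by (simp add: L_def)
    qed
    also have "\<dots> = (L * mat_adjoint ?V) $$ (a, j)"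
      by (rule mat_mult_index_sum[OF L mat_adjoint_carrier[OF V'] aj, symmetric])
    finally show "(?X * mat_adjoint V) $$ (a, j) = (L * mat_adjoint ?V) $$ (a, j)" .
  qed (use L X V in auto)
  then show thesis using that L by blast
qed

text \<open>The optimal approximation has every block of the form \<open>L\<close> times the adjoint
  of a block of \<open>V\<close>, with a common \<open>L\<close>. Relations among the blocks of
  \<open>V\<close> therefore carry over to it by left multiplication. The rank bound comes from the
  \<open>n\<close> columns of \<open>L\<close>, optimality from Eckart-Young.\<close>

lemma best_low_rank_coeff_row:
  assumes svd: "svd_split m ((k + 1) * n) n (coeff_row k m A B) U S V" and nm: "n \<le> m"
    and A: "A \<in> carrier_mat m n" and B: "\<forall>s\<in>{1..k}. B s \<in> carrier_mat m n"
  shows "\<exists>L. L \<in> carrier_mat m n \<and>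
    vec_space.rank m (coeff_row k m (L * mat_adjoint (block_r1 n V 1))
      (\<lambda>s. L * mat_adjoint (block_r1 n V (s + 1)))) \<le> n \<and>
    (\<forall>Ah Bh. Ah \<in> carrier_mat m n \<longrightarrow> (\<forall>s\<in>{1..k}. Bh s \<in> carrier_mat m n) \<longrightarrow>
      vec_space.rank m (coeff_row k m Ah Bh) \<le> n \<longrightarrow>
      (frobenius_norm (coeff_row k m (L * mat_adjoint (block_r1 n V 1) - A)
        (\<lambda>s. L * mat_adjoint (block_r1 n V (s + 1)) - B s)))\<^sup>2
      \<le> (frobenius_norm (coeff_row k m (Ah - A) (\<lambda>s. Bh s - B s)))\<^sup>2)"
proof -
  let ?q = "(k + 1) * n"
  have nq: "n \<le> ?q" by simp
  have U: "U \<in> carrier_mat m (min m ?q)" and S: "S \<in> carrier_mat (min m ?q) ?q"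
    and Sd: "diagonal_mat S" and V: "V \<in> carrier_mat ?q ?q"
    using svd unfolding svd_split_def by auto
  let ?V = "mat ?q n (\<lambda>(a, b). V $$ (a, b))"
  obtain L where L: "L \<in> carrier_mat m n"
    and LV: "U * map_mat complex_of_real (leading_part n S) * mat_adjoint V = L * mat_adjoint ?V"
    using truncated_svd_factor[OF U S Sd V nq] .
  let ?A = "L * mat_adjoint (block_r1 n V 1)"
  let ?B = "\<lambda>s. L * mat_adjoint (block_r1 n V (s + 1))"
  have A': "?A \<in> carrier_mat m n" and B': "\<forall>s\<in>{1..k}. ?B s \<in> carrier_mat m n"
    using L by (auto intro!: mult_carrier_mat mat_adjoint_carrier)
  note row = coeff_row_mult_blocks[OF L V]
  show ?thesis
  proof (intro exI[of _ L] conjI allI impI L)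
    show "vec_space.rank m (coeff_row k m ?A ?B) \<le> n"
      unfolding row by (rule rank_mult_le[OF L, of _ ?q]) (intro mat_adjoint_carrier mat_carrier)
    fix Ah Bh assume Ah: "Ah \<in> carrier_mat m n" and Bh: "\<forall>s\<in>{1..k}. Bh s \<in> carrier_mat m n"
      and rk: "vec_space.rank m (coeff_row k m Ah Bh) \<le> n"
    show "(frobenius_norm (coeff_row k m (?A - A) (\<lambda>s. ?B s - B s)))\<^sup>2
      \<le> (frobenius_norm (coeff_row k m (Ah - A) (\<lambda>s. Bh s - B s)))\<^sup>2"
      unfolding coeff_row_diff[OF A B A' B'] coeff_row_diff[OF A B Ah Bh] row LV[symmetric]
      by (rule eckart_young_frobenius[OF svd nm nq coeff_row_carrier[OF Ah Bh] rk])
  qed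
qed

section \<open>Finite sums of matrices and of vectors\<close>

lemma finsum_mat_carrier_index:
  assumes "finite K" "\<And>s. s \<in> K \<Longrightarrow> f s \<in> carrier_mat m n"
  shows "finsum (module_mat TYPE(complex) m n) f K \<in> carrier_mat m n"
    and "a < m \<Longrightarrow> b < n \<Longrightarrow> finsum (module_mat TYPE(complex) m n) f K $$ (a, b) = (\<Sum>s\<in>K. f s $$ (a, b))"
proof -
  interpret abelian_group "module_mat TYPE(complex) m n" by (rule abelian_group_mat)
  \<comment> \<open>Membership in the carrier and the entry formula are proved in one induction:
    reading off an entry of the enlarged sum requires the dimensions of the smaller one.\<close>
  have "finsum (module_mat TYPE(complex) m n) f K \<in> carrier_mat m n \<and>
    (a < m \<longrightarrow> b < n \<longrightarrow> finsum (module_mat TYPE(complex) m n) f K $$ (a, b) = (\<Sum>s\<in>K. f s $$ (a, b)))"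
    using assms
  proof (induction K)
    case empty
    then show ?case by (simp add: module_mat_simps)
  next
    case (insert s K)
    then have "f \<in> K \<rightarrow> carrier (module_mat TYPE(complex) m n)" "f s \<in> carrier (module_mat TYPE(complex) m n)"
      by (auto simp: module_mat_simps)
    from finsum_insert[OF insert(1,2) this] insert show ?case
      by (auto simp: module_mat_simps)
  qed
  then show "finsum (module_mat TYPE(complex) m n) f K \<in> carrier_mat m n"
    "a < m \<Longrightarrow> b < n \<Longrightarrow> finsum (module_mat TYPE(complex) m n) f K $$ (a, b) = (\<Sum>s\<in>K. f s $$ (a, b))"
    by auto
qed

lemma mult_finsum_vec:
  assumes L: "L \<in> carrier_mat m n" and K: "finite K" and f: "\<And>s. s \<in> K \<Longrightarrow> f s \<in> carrier_vec n"
  shows "L *\<^sub>v finsum_vec TYPE(complex) n f K = finsum_vec TYPE(complex) m (\<lambda>s. L *\<^sub>v f s) K"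
proof -
  have f': "f \<in> K \<rightarrow> carrier_vec n" and Lf': "(\<lambda>s. L *\<^sub>v f s) \<in> K \<rightarrow> carrier_vec m"
    using f L by auto
  have c: "finsum_vec TYPE(complex) n f K \<in> carrier_vec n"
    "finsum_vec TYPE(complex) m (\<lambda>s. L *\<^sub>v f s) K \<in> carrier_vec m"
    using finsum_vec_closed[OF f'] finsum_vec_closed[OF Lf'] by auto
  show ?thesis
  proof (rule eq_vecI)
    fix i assume "i < dim_vec (finsum_vec TYPE(complex) m (\<lambda>s. L *\<^sub>v f s) K)"
    then have i: "i < m" using c by auto
    have "(L *\<^sub>v finsum_vec TYPE(complex) n f K) $ i = (\<Sum>l<n. \<Sum>s\<in>K. L $$ (i, l) * f s $ l)"
      unfolding mat_vec_index_sum[OF L c(1) i]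
      by (rule sum.cong[OF refl]) (use index_finsum_vec[OF K _ f'] in \<open>auto simp: sum_distrib_left\<close>)
    also have "\<dots> = (\<Sum>s\<in>K. \<Sum>l<n. L $$ (i, l) * f s $ l)" by (rule sum.swap)
    also have "\<dots> = (\<Sum>s\<in>K. (L *\<^sub>v f s) $ i)"
      by (rule sum.cong[OF refl]) (metis mat_vec_index_sum[OF L f i])
    also have "\<dots> = finsum_vec TYPE(complex) m (\<lambda>s. L *\<^sub>v f s) K $ i"
      using index_finsum_vec[OF K i Lf'] by simp
    finally show "(L *\<^sub>v finsum_vec TYPE(complex) n f K) $ i =
      finsum_vec TYPE(complex) m (\<lambda>s. L *\<^sub>v f s) K $ i" .
  qed (use L c in auto)
qed

section \<open>Euclidean norms and the strictly contracting first block\<close>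

lemma mat_of_col_carrier [simp]: "mat_of_cols n [v] \<in> carrier_mat n (Suc 0)"
  using mat_of_cols_carrier(1)[of n "[v]"] by simp

text \<open>Treating a vector as a one-column matrix makes the isometry and adjoint rules of the
  Frobenius norm available for Euclidean norms.\<close>

lemma frobenius_norm_mat_of_col:
  assumes M: "M \<in> carrier_mat m n" and v: "v \<in> carrier_vec n"
  shows "frobenius_norm (M * mat_of_cols n [v]) = euclid_norm (M *\<^sub>v v)"
proof -
  have X: "mat_of_cols n [v] \<in> carrier_mat n 1" by simp
  have MX: "M * mat_of_cols n [v] \<in> carrier_mat m 1" using M by auto
  have e: "(M * mat_of_cols n [v]) $$ (i, 0) = (M *\<^sub>v v) $ i" if "i < m" for i
    using M v that by (auto simp: col_mat_of_cols)
  have "(frobenius_norm (M * mat_of_cols n [v]))\<^sup>2 = (\<Sum>i<m. (cmod ((M * mat_of_cols n [v]) $$ (i, 0)))\<^sup>2)"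
    using frobenius_norm_sq_sum[OF MX] by simp
  also have "\<dots> = (\<Sum>i<m. (cmod ((M *\<^sub>v v) $ i))\<^sup>2)"
    by (rule sum.cong[OF refl]) (simp only: e lessThan_iff)
  also have "\<dots> = (euclid_norm (M *\<^sub>v v))\<^sup>2"
    using M unfolding euclid_norm_def L2_set_def by (simp add: sum_nonneg)
  finally show ?thesis
    by (metis L2_set_nonneg euclid_norm_def frobenius_norm_nonneg power2_eq_iff_nonneg)
qed

lemma euclid_norm_smult: "euclid_norm (c \<cdot>\<^sub>v v) = cmod c * euclid_norm v"
  unfolding euclid_norm_def by (subst L2_set_right_distrib) (auto simp: norm_mult intro!: L2_set_cong)

lemma euclid_norm_eq_0_iff:
  assumes "v \<in> carrier_vec n"
  shows "euclid_norm v = 0 \<longleftrightarrow> v = 0\<^sub>v n"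
  using assms unfolding euclid_norm_def by (auto simp: L2_set_eq_0_iff)

lemma sum_block_split:
  fixes f :: "nat \<Rightarrow> 'a :: comm_monoid_add"
  shows "(\<Sum>j<K * n. f j) = (\<Sum>r<K. \<Sum>b<n. f (r * n + b))"
proof (induction K)
  case (Suc K)
  have "(\<Sum>j<Suc K * n. f j) = (\<Sum>j<K * n. f j) + (\<Sum>j\<in>{K * n..<K * n + n}. f j)"
    unfolding lessThan_atLeast0 by (subst sum.atLeastLessThan_concat) (auto simp: add.commute)
  also have "(\<Sum>j\<in>{K * n..<K * n + n}. f j) = (\<Sum>b<n. f (K * n + b))"
    using sum.shift_bounds_nat_ivl[of f 0 "K * n" n] by (simp add: lessThan_atLeast0 add.commute)
  finally show ?case using Suc by simp
qed simp

text \<open>The first \<open>n\<close> columns of \<open>V\<close> are orthonormal; the sum over all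
  rows in their Gram matrix is split into the \<open>k + 1\<close> block rows.\<close>

lemma blocks_gram:
  assumes V: "V \<in> carrier_mat ((k + 1) * n) ((k + 1) * n)"
    and VV: "mat_adjoint V * V = 1\<^sub>m ((k + 1) * n)" and ab: "a < n" "b < n"
  shows "(mat_adjoint (block_r1 n V 1) * block_r1 n V 1) $$ (a, b) +
    (\<Sum>s\<in>{1..k}. (mat_adjoint (block_r1 n V (s + 1)) * block_r1 n V (s + 1)) $$ (a, b)) = 1\<^sub>m n $$ (a, b)"
proof -
  let ?q = "(k + 1) * n"
  define g where "g r = (mat_adjoint (block_r1 n V (r + 1)) * block_r1 n V (r + 1)) $$ (a, b)" for r
  have q: "a < ?q" "b < ?q" using ab by auto
  have g: "g r = (\<Sum>t<n. cnj (V $$ (r * n + t, a)) * V $$ (r * n + t, b))" for r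
    unfolding g_def mat_mult_index_sum[OF mat_adjoint_carrier[OF block_r1_carrier] block_r1_carrier ab]
    by (rule sum.cong[OF refl])
      (use ab in \<open>simp add: mat_adjoint_index[of a "block_r1 n V (r + 1)" for r] block_r1_def\<close>)
  have "1\<^sub>m n $$ (a, b) = (mat_adjoint V * V) $$ (a, b)" unfolding VV using ab q by simp
  also have "\<dots> = (\<Sum>j<?q. cnj (V $$ (j, a)) * V $$ (j, b))"
    unfolding mat_mult_index_sum[OF mat_adjoint_carrier[OF V] V q]
    by (rule sum.cong[OF refl]) (use V q in \<open>simp add: mat_adjoint_index[of a V]\<close>)
  also have "\<dots> = (\<Sum>r<k + 1. g r)" unfolding sum_block_split g ..
  also have "\<dots> = g 0 + (\<Sum>s\<in>{1..k}. g s)"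
    by (simp add: sum.lessThan_Suc_shift sum.atLeast1_atMost_eq del: sum.lessThan_Suc)
  finally show ?thesis by (simp add: g_def)
qed

text \<open>Makes the set in \<open>spectral_norm\<close> bounded above. Padding \<open>v\<close>
  with zeros to \<open>w\<close> exhibits the block times \<open>v\<close> as the first
  \<open>n\<close> entries of \<open>V *\<^sub>v w\<close>, and \<open>V\<close> preserves the
  norm.\<close>

lemma euclid_norm_block_le:
  assumes V: "V \<in> carrier_mat ((k + 1) * n) ((k + 1) * n)"
    and VV: "mat_adjoint V * V = 1\<^sub>m ((k + 1) * n)" and v: "v \<in> carrier_vec n"
  shows "euclid_norm (block_r1 n V 1 *\<^sub>v v) \<le> euclid_norm v"
proof -
  let ?q = "(k + 1) * n"
  define w where "w = vec ?q (\<lambda>i. if i < n then v $ i else 0)"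
  have w: "w \<in> carrier_vec ?q" by (simp add: w_def)
  have nq: "n \<le> ?q" by simp
  have sq: "(euclid_norm u)\<^sup>2 = (\<Sum>i<dim_vec u. (cmod (u $ i))\<^sup>2)" for u
    unfolding euclid_norm_def L2_set_def by (simp add: sum_nonneg)
  have e: "(block_r1 n V 1 *\<^sub>v v) $ i = (V *\<^sub>v w) $ i" if i: "i < n" for i
  proof -
    have "(V *\<^sub>v w) $ i = (\<Sum>l<?q. V $$ (i, l) * w $ l)"
      by (rule mat_vec_index_sum[OF V w]) (use i nq in linarith)
    also have "\<dots> = (\<Sum>l<n. V $$ (i, l) * v $ l)"
      by (rule sum.mono_neutral_cong_right) (use nq in \<open>auto simp: w_def\<close>)
    also have "\<dots> = (block_r1 n V 1 *\<^sub>v v) $ i"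
      unfolding mat_vec_index_sum[OF block_r1_carrier v i]
      by (rule sum.cong[OF refl]) (use i in \<open>simp add: block_r1_def\<close>)
    finally show ?thesis by simp
  qed
  have "(euclid_norm (block_r1 n V 1 *\<^sub>v v))\<^sup>2 = (\<Sum>i<n. (cmod ((V *\<^sub>v w) $ i))\<^sup>2)"
    unfolding sq by (rule sum.cong) (simp, simp only: e lessThan_iff)
  also have "\<dots> \<le> (\<Sum>i<?q. (cmod ((V *\<^sub>v w) $ i))\<^sup>2)"
    using nq by (intro sum_mono2) auto
  also have "\<dots> = (euclid_norm (V *\<^sub>v w))\<^sup>2" unfolding sq using V by simp
  also have "euclid_norm (V *\<^sub>v w) = frobenius_norm (V * mat_of_cols ?q [w])"
    by (rule frobenius_norm_mat_of_col[OF V w, symmetric])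
  also have "\<dots> = frobenius_norm (mat_of_cols ?q [w])"
    by (rule frobenius_norm_isometry[OF V VV mat_of_col_carrier])
  also have "\<dots> = frobenius_norm (1\<^sub>m ?q * mat_of_cols ?q [w])"
    by (subst left_mult_one_mat[OF mat_of_col_carrier]) simp
  also have "\<dots> = euclid_norm w"
    using frobenius_norm_mat_of_col[OF one_carrier_mat w] one_mult_mat_vec[OF w] by simp
  also have "(euclid_norm w)\<^sup>2 = (\<Sum>i<n. (cmod (v $ i))\<^sup>2)"
    unfolding sq using nq by (simp add: w_def) (rule sum.mono_neutral_cong_right, auto)
  also have "\<dots> = (euclid_norm v)\<^sup>2" unfolding sq using v by simp
  finally show ?thesis by (rule power2_le_imp_le) (simp add: euclid_norm_def)
qed

text \<open>If the block times its adjoint in this order fixes \<open>v\<close>, then moving the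
  adjoint across the inner product shows that the block preserves the length of \<open>v\<close>; a
  strict contraction does so only for 0.\<close>

lemma block_fixed_imp_zero:
  assumes V: "V \<in> carrier_mat ((k + 1) * n) ((k + 1) * n)"
    and VV: "mat_adjoint V * V = 1\<^sub>m ((k + 1) * n)"
    and sn: "spectral_norm (block_r1 n V 1) < 1" and v: "v \<in> carrier_vec n"
    and fix_v: "mat_adjoint (block_r1 n V 1) *\<^sub>v (block_r1 n V 1 *\<^sub>v v) = v"
  shows "v = 0\<^sub>v n"
proof (rule ccontr)
  let ?V = "block_r1 n V 1"
  let ?E = "{euclid_norm (?V *\<^sub>v v) | v. v \<in> carrier_vec (dim_col ?V) \<and> euclid_norm v \<le> 1}"
  assume "v \<noteq> 0\<^sub>v n"
  then have v0: "euclid_norm v > 0"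
    using euclid_norm_eq_0_iff[OF v] by (simp add: euclid_norm_def order_less_le)
  define w where "w = complex_of_real (1 / euclid_norm v) \<cdot>\<^sub>v v"
  have w: "w \<in> carrier_vec n" using v by (simp add: w_def)
  have w1: "euclid_norm w = 1" unfolding w_def euclid_norm_smult using v0 by (simp add: norm_divide)
  have B: "?V \<in> carrier_mat n n" and BH: "mat_adjoint ?V \<in> carrier_mat n n"
    by (auto intro: mat_adjoint_carrier)
  \<comment> \<open>The real supremum bounds its members only once the set is known to be
    bounded.\<close>
  have bdd: "bdd_above ?E"
    using euclid_norm_block_le[OF V VV] by (intro bdd_aboveI[of _ 1]) (force simp: block_r1_def)
  have "euclid_norm (?V *\<^sub>v w) \<in> ?E" using w w1 by (auto simp: block_r1_def)
  then have "euclid_norm (?V *\<^sub>v w) \<le> spectral_norm ?V"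
    unfolding spectral_norm_def using bdd by (rule cSup_upper)
  then have lt: "euclid_norm (?V *\<^sub>v w) < 1" using sn by simp
  have fix_w: "mat_adjoint ?V *\<^sub>v (?V *\<^sub>v w) = w"
    unfolding w_def mult_mat_vec[OF B v] mult_mat_vec[OF BH mult_mat_vec_carrier[OF B v]] fix_v ..
  \<comment> \<open>The unit vector \<open>w\<close> becomes a one-column matrix, so that
    \<open>mat_inner_mult_left\<close> can move the adjoint.\<close>
  define X where "X = mat_of_cols n [w]"
  have X: "X \<in> carrier_mat n 1" by (simp add: X_def)
  have "mat_adjoint ?V * (?V * X) = X"
  proof (rule eq_matI)
    fix i j assume "i < dim_row X" "j < dim_col X"
    then have ij: "i < n" "j = 0" using X by auto
    have "col (?V * X) 0 = ?V *\<^sub>v w"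
      using col_mult2[OF B X, of 0] w by (simp add: X_def col_mat_of_cols)
    then have "col (mat_adjoint ?V * (?V * X)) 0 = w"
      using col_mult2[OF BH mult_carrier_mat[OF B X], of 0] fix_w by simp
    then have "col (mat_adjoint ?V * (?V * X)) 0 $ i = w $ i" by simp
    moreover have "mat_adjoint ?V * (?V * X) \<in> carrier_mat n 1" using BH B X by (intro mult_carrier_mat)
    ultimately show "(mat_adjoint ?V * (?V * X)) $$ (i, j) = X $$ (i, j)"
      using ij w by (auto simp: X_def mat_of_cols_def simp del: index_mult_mat(1))
  qed (use B X in auto)
  then have "mat_inner (?V * X) (?V * X) = mat_inner X X"
    using mat_inner_mult_left[OF B X mult_carrier_mat[OF B X]] by simp
  then have "(frobenius_norm (?V * X))\<^sup>2 = (frobenius_norm X)\<^sup>2"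
    unfolding mat_inner_self by (metis of_real_eq_iff)
  then have "frobenius_norm (?V * X) = frobenius_norm (1\<^sub>m n * X)"
    using frobenius_norm_nonneg power2_eq_iff_nonneg left_mult_one_mat[OF X] by metis
  then have "euclid_norm (?V *\<^sub>v w) = euclid_norm w"
    unfolding X_def frobenius_norm_mat_of_col[OF B w] frobenius_norm_mat_of_col[OF one_carrier_mat w]
    using one_mult_mat_vec[OF w] by simp
  then show False using lt w1 by simp
qed

text \<open>The Gram matrix of the blocks \<open>2, \<dots>, k + 1\<close> is the identity minus that of block 1,
  which has no eigenvalue 1 because block 1 is a strict contraction.\<close>

lemma first_block_combination:
  assumes V: "V \<in> carrier_mat ((k + 1) * n) ((k + 1) * n)"
    and VV: "mat_adjoint V * V = 1\<^sub>m ((k + 1) * n)"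
    and sn: "spectral_norm (block_r1 n V 1) < 1"
  shows "\<exists>X. (\<forall>s. X s \<in> carrier_mat n n) \<and>
    (\<forall>a<n. \<forall>b<n. mat_adjoint (block_r1 n V 1) $$ (a, b) =
      (\<Sum>s\<in>{1..k}. (mat_adjoint (block_r1 n V (s + 1)) * X s) $$ (a, b)))"
proof -
  let ?V = "\<lambda>s. block_r1 n V s"
  let ?G = "\<lambda>s. mat_adjoint (?V s) * ?V s"
  have BH: "mat_adjoint (?V s) \<in> carrier_mat n n" for s by (auto intro: mat_adjoint_carrier)
  have G: "?G s \<in> carrier_mat n n" for s by (rule mult_carrier_mat[OF BH block_r1_carrier])
  define W where "W = 1\<^sub>m n - ?G 1"
  have W: "W \<in> carrier_mat n n" unfolding W_def using G by (intro minus_carrier_mat) auto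
  have W_index: "W $$ (a, b) = (\<Sum>s\<in>{1..k}. ?G (s + 1) $$ (a, b))" if "a < n" "b < n" for a b
  proof -
    have "W $$ (a, b) = 1\<^sub>m n $$ (a, b) - ?G 1 $$ (a, b)"
      unfolding W_def using that G[of 1] by (intro index_minus_mat(1)) auto
    then show ?thesis unfolding blocks_gram[OF V VV that, symmetric] by (simp only: add_diff_cancel_left')
  qed
  have "det W \<noteq> 0"
  proof
    assume "det W = 0"
    \<comment> \<open>A kernel vector of \<open>W\<close> is a fixed vector of \<open>?G 1\<close>,
      which has to be 0.\<close>
    then obtain v where v: "v \<in> carrier_vec n" "v \<noteq> 0\<^sub>v n" "W *\<^sub>v v = 0\<^sub>v n"
      using det_0_iff_vec_prod_zero_field[OF W] by auto
    have "W *\<^sub>v v = v - ?G 1 *\<^sub>v v"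
      unfolding W_def using minus_mult_distrib_mat_vec[OF one_carrier_mat G v(1)] v(1) by simp
    then have z: "v - ?G 1 *\<^sub>v v = 0\<^sub>v n" using v by simp
    have Gv: "?G 1 *\<^sub>v v \<in> carrier_vec n" using G v(1) by (rule mult_mat_vec_carrier)
    have "?G 1 *\<^sub>v v = v"
    proof (rule eq_vecI)
      fix i assume "i < dim_vec v"
      then show "(?G 1 *\<^sub>v v) $ i = v $ i"
        using z Gv v(1) by (metis carrier_vecD eq_iff_diff_eq_0 index_minus_vec(1) index_zero_vec(1))
    qed (use Gv v in auto)
    then have "mat_adjoint (?V 1) *\<^sub>v (?V 1 *\<^sub>v v) = v"
      using assoc_mult_mat_vec[OF BH block_r1_carrier v(1)] by metis
    then show False using block_fixed_imp_zero[OF V VV sn v(1)] v(2) by blast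
  qed
  then obtain W' where W': "W' \<in> carrier_mat n n" "W * W' = 1\<^sub>m n"
    using det_non_zero_imp_unit[OF W, of "()"] by (auto simp: Units_def ring_mat_simps)
  \<comment> \<open>With this \<open>Y\<close>, the candidates \<open>?V (s + 1) * Y\<close> combine
    to \<open>W * Y\<close>, which is the adjoint of the first block.\<close>
  define Y where "Y = W' * mat_adjoint (?V 1)"
  have Y: "Y \<in> carrier_mat n n" unfolding Y_def using W' BH by (intro mult_carrier_mat)
  have WY: "W * Y = mat_adjoint (?V 1)"
    unfolding Y_def using assoc_mult_mat[OF W W'(1) BH] W'(2) left_mult_one_mat[OF BH] by metis
  show ?thesis
  proof (intro exI[of _ "\<lambda>s. ?V (s + 1) * Y"] conjI allI impI)
    show "?V (s + 1) * Y \<in> carrier_mat n n" for s by (rule mult_carrier_mat[OF block_r1_carrier Y])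
    fix a b assume ab: "a < n" "b < n"
    have "mat_adjoint (?V 1) $$ (a, b) = (\<Sum>l<n. W $$ (a, l) * Y $$ (l, b))"
      unfolding WY[symmetric] by (rule mat_mult_index_sum[OF W Y ab])
    also have "\<dots> = (\<Sum>l<n. \<Sum>s\<in>{1..k}. ?G (s + 1) $$ (a, l) * Y $$ (l, b))"
      by (rule sum.cong[OF refl]) (use ab W_index in \<open>simp add: sum_distrib_right del: index_mult_mat(1)\<close>)
    also have "\<dots> = (\<Sum>s\<in>{1..k}. \<Sum>l<n. ?G (s + 1) $$ (a, l) * Y $$ (l, b))" by (rule sum.swap)
    also have "\<dots> = (\<Sum>s\<in>{1..k}. (?G (s + 1) * Y) $$ (a, b))"
      unfolding mat_mult_index_sum[OF G Y ab] ..
    also have "\<dots> = (\<Sum>s\<in>{1..k}. (mat_adjoint (?V (s + 1)) * (?V (s + 1) * Y)) $$ (a, b))"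
      unfolding assoc_mult_mat[OF BH block_r1_carrier Y] ..
    finally show "mat_adjoint (?V 1) $$ (a, b) =
      (\<Sum>s\<in>{1..k}. (mat_adjoint (?V (s + 1)) * (?V (s + 1) * Y)) $$ (a, b))" .
  qed
qed

section \<open>Left multiples of the blocks satisfy the constraints of both problems\<close>

lemma mult_first_block_eq_finsum:
  assumes V: "V \<in> carrier_mat ((k + 1) * n) ((k + 1) * n)"
    and VV: "mat_adjoint V * V = 1\<^sub>m ((k + 1) * n)"
    and sn: "spectral_norm (block_r1 n V 1) < 1" and L: "L \<in> carrier_mat m n"
  shows "\<exists>X. (\<forall>s. X s \<in> carrier_mat n n) \<and> L * mat_adjoint (block_r1 n V 1) =
    finsum (module_mat TYPE(complex) m n) (\<lambda>s. L * mat_adjoint (block_r1 n V (s + 1)) * X s) {1..k}"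
proof -
  let ?V = "\<lambda>s. block_r1 n V s"
  \<comment> \<open>The coefficient matrices for the blocks of \<open>V\<close> stay the same after
    left multiplication by \<open>L\<close>.\<close>
  obtain X where X: "\<And>s. X s \<in> carrier_mat n n"
    and VX: "\<And>a b. a < n \<Longrightarrow> b < n \<Longrightarrow> mat_adjoint (?V 1) $$ (a, b) =
      (\<Sum>s\<in>{1..k}. (mat_adjoint (?V (s + 1)) * X s) $$ (a, b))"
    using first_block_combination[OF V VV sn] by blast
  have BH: "mat_adjoint (?V s) \<in> carrier_mat n n" for s by (auto intro: mat_adjoint_carrier)
  have HX: "mat_adjoint (?V (s + 1)) * X s \<in> carrier_mat n n" for s using BH X by (intro mult_carrier_mat)
  define f where "f s = L * mat_adjoint (?V (s + 1)) * X s" for s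
  have f_assoc: "f s = L * (mat_adjoint (?V (s + 1)) * X s)" for s
    unfolding f_def by (rule assoc_mult_mat[OF L BH X])
  have f: "f s \<in> carrier_mat m n" for s unfolding f_assoc by (rule mult_carrier_mat[OF L HX])
  note fs = finsum_mat_carrier_index[where f = f, OF finite_atLeastAtMost[of 1 k] f]
  have LH: "L * mat_adjoint (?V 1) \<in> carrier_mat m n" by (rule mult_carrier_mat[OF L BH])
  have "L * mat_adjoint (?V 1) = finsum (module_mat TYPE(complex) m n) f {1..k}"
  proof (rule eq_matI)
    fix a b assume "a < dim_row (finsum (module_mat TYPE(complex) m n) f {1..k})"
      "b < dim_col (finsum (module_mat TYPE(complex) m n) f {1..k})"
    then have ab: "a < m" "b < n" using fs(1) by auto
    have "(L * mat_adjoint (?V 1)) $$ (a, b) = (\<Sum>l<n. L $$ (a, l) * mat_adjoint (?V 1) $$ (l, b))"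
      by (rule mat_mult_index_sum[OF L BH ab])
    also have "\<dots> = (\<Sum>l<n. \<Sum>s\<in>{1..k}. L $$ (a, l) * (mat_adjoint (?V (s + 1)) * X s) $$ (l, b))"
      by (rule sum.cong[OF refl]) (use ab VX in \<open>simp add: sum_distrib_left del: index_mult_mat(1) mat_adjoint_index\<close>)
    also have "\<dots> = (\<Sum>s\<in>{1..k}. \<Sum>l<n. L $$ (a, l) * (mat_adjoint (?V (s + 1)) * X s) $$ (l, b))"
      by (rule sum.swap)
    also have "\<dots> = (\<Sum>s\<in>{1..k}. f s $$ (a, b))"
      unfolding f_assoc mat_mult_index_sum[OF L HX ab] ..
    also have "\<dots> = finsum (module_mat TYPE(complex) m n) f {1..k} $$ (a, b)"
      by (rule fs(2)[OF ab, symmetric])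
    finally show "(L * mat_adjoint (?V 1)) $$ (a, b) = finsum (module_mat TYPE(complex) m n) f {1..k} $$ (a, b)" .
  qed (use fs(1) LH in auto)
  then show ?thesis using X unfolding f_def by blast
qed

text \<open>Applying \<open>L i\<close> to both sides of the eigenvalue equations preserves them by
  linearity. Scalars and vectors are unchanged, hence so are their Kronecker products and the
  independence of these; only the row dimension passes from \<open>n i\<close> to
  \<open>m i\<close>.\<close>

lemma indep_eigentuples_mult_left:
  assumes e: "indep_eigentuples k n n A B N lam x"
    and A: "\<And>i. i \<in> {1..k} \<Longrightarrow> A i \<in> carrier_mat (n i) (n i)"
    and B: "\<And>i s. i \<in> {1..k} \<Longrightarrow> s \<in> {1..k} \<Longrightarrow> B i s \<in> carrier_mat (n i) (n i)"
    and L: "\<And>i. i \<in> {1..k} \<Longrightarrow> L i \<in> carrier_mat (m i) (n i)"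
  shows "indep_eigentuples k m n (\<lambda>i. L i * A i) (\<lambda>i s. L i * B i s) N lam x"
proof -
  have "(L i * A i) *\<^sub>v x i j =
      finsum_vec TYPE(complex) (m i) (\<lambda>s. lam s j \<cdot>\<^sub>v ((L i * B i s) *\<^sub>v x i j)) {1..k}"
    if i: "i \<in> {1..k}" and j: "j \<in> {1..N}" for i j
  proof -
    have x: "x i j \<in> carrier_vec (n i)" using e i j unfolding indep_eigentuples_def by blast
    have Bx: "B i s *\<^sub>v x i j \<in> carrier_vec (n i)" if "s \<in> {1..k}" for s
      using B[OF i that] x by (rule mult_mat_vec_carrier)
    have "(L i * A i) *\<^sub>v x i j = L i *\<^sub>v (A i *\<^sub>v x i j)"
      by (rule assoc_mult_mat_vec[OF L[OF i] A[OF i] x])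
    also have "A i *\<^sub>v x i j = finsum_vec TYPE(complex) (n i) (\<lambda>s. lam s j \<cdot>\<^sub>v (B i s *\<^sub>v x i j)) {1..k}"
      using e i j unfolding indep_eigentuples_def by blast
    also have "L i *\<^sub>v \<dots> = finsum_vec TYPE(complex) (m i) (\<lambda>s. L i *\<^sub>v (lam s j \<cdot>\<^sub>v (B i s *\<^sub>v x i j))) {1..k}"
      by (rule mult_finsum_vec[OF L[OF i]]) (use Bx in auto)
    also have "\<dots> = finsum_vec TYPE(complex) (m i) (\<lambda>s. lam s j \<cdot>\<^sub>v ((L i * B i s) *\<^sub>v x i j)) {1..k}"
    proof (rule eq_vecI)
      have eq: "L i *\<^sub>v (lam s j \<cdot>\<^sub>v (B i s *\<^sub>v x i j)) = lam s j \<cdot>\<^sub>v ((L i * B i s) *\<^sub>v x i j)"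
        if s: "s \<in> {1..k}" for s
        using mult_mat_vec[OF L[OF i] Bx[OF s]] assoc_mult_mat_vec[OF L[OF i] B[OF i s] x] by simp
      have F: "(\<lambda>s. lam s j \<cdot>\<^sub>v ((L i * B i s) *\<^sub>v x i j)) \<in> {1..k} \<rightarrow> carrier_vec (m i)"
        using L[OF i] B[OF i] by (auto intro!: mult_mat_vec_carrier[OF _ x] mult_carrier_mat)
      then have F': "(\<lambda>s. L i *\<^sub>v (lam s j \<cdot>\<^sub>v (B i s *\<^sub>v x i j))) \<in> {1..k} \<rightarrow> carrier_vec (m i)"
        using eq by (auto simp: Pi_iff)
      note closed = finsum_vec_closed[OF F] finsum_vec_closed[OF F']
      show "dim_vec (finsum_vec TYPE(complex) (m i) (\<lambda>s. L i *\<^sub>v (lam s j \<cdot>\<^sub>v (B i s *\<^sub>v x i j))) {1..k}) =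
          dim_vec (finsum_vec TYPE(complex) (m i) (\<lambda>s. lam s j \<cdot>\<^sub>v ((L i * B i s) *\<^sub>v x i j)) {1..k})"
        using closed by simp
      fix l assume "l < dim_vec (finsum_vec TYPE(complex) (m i) (\<lambda>s. lam s j \<cdot>\<^sub>v ((L i * B i s) *\<^sub>v x i j)) {1..k})"
      then have l: "l < m i" using closed by simp
      show "finsum_vec TYPE(complex) (m i) (\<lambda>s. L i *\<^sub>v (lam s j \<cdot>\<^sub>v (B i s *\<^sub>v x i j))) {1..k} $ l =
          finsum_vec TYPE(complex) (m i) (\<lambda>s. lam s j \<cdot>\<^sub>v ((L i * B i s) *\<^sub>v x i j)) {1..k} $ l"
        unfolding index_finsum_vec[OF finite_atLeastAtMost l F] index_finsum_vec[OF finite_atLeastAtMost l F']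
        by (rule sum.cong[OF refl]) (simp only: eq)
    qed
    finally show ?thesis .
  qed
  then show ?thesis using e unfolding indep_eigentuples_def by blast
qed

section \<open>Equality of the infima\<close>

theorem theorem5p3:
  fixes k :: nat and m n :: "nat \<Rightarrow> nat"
    and A :: "nat \<Rightarrow> complex mat" and B :: "nat \<Rightarrow> nat \<Rightarrow> complex mat"
    and U V :: "nat \<Rightarrow> complex mat" and S :: "nat \<Rightarrow> real mat"
    and N :: nat
  assumes "1 \<le> k"
    and "\<And>i. i \<in> {1..k} \<Longrightarrow> n i \<le> m i"
    and "mep_coeffs k m n A B"
    and "N = (\<Prod>i\<in>{1..k}. n i)"
    and "\<And>i. i \<in> {1..k} \<Longrightarrow>
           svd_split (m i) ((k + 1) * n i) (n i) (coeff_row k (m i) (A i) (B i)) (U i) (S i) (V i)"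
    and "\<And>i. i \<in> {1..k} \<Longrightarrow> spectral_norm (block_r1 (n i) (V i) 1) < 1"
    and "\<exists>lam x.
           (\<forall>i\<in>{1..k}. \<forall>j\<in>{1..N}. x i j \<noteq> 0\<^sub>v (n i)) \<and>
           indep_eigentuples k n n
             (\<lambda>i. mat_adjoint (block_r1 (n i) (V i) 1))
             (\<lambda>i s. mat_adjoint (block_r1 (n i) (V i) (s + 1)))
             N lam x"
  shows "phi k m n A B = theta_tilde k m n A B N"
proof -
  let ?H = "\<lambda>i r. mat_adjoint (block_r1 (n i) (V i) r)"
  have A: "\<And>i. i \<in> {1..k} \<Longrightarrow> A i \<in> carrier_mat (m i) (n i)"
    and B: "\<And>i. i \<in> {1..k} \<Longrightarrow> \<forall>s\<in>{1..k}. B i s \<in> carrier_mat (m i) (n i)"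
    using assms(3) unfolding mep_coeffs_def by auto
  have H: "?H i r \<in> carrier_mat (n i) (n i)" for i r by (auto intro: mat_adjoint_carrier)
  \<comment> \<open>Bundles feasibility of rank with optimality, so that one choice over
    \<open>i\<close> provides all the factors \<open>L i\<close>.\<close>
  define best where "best i L \<longleftrightarrow> L \<in> carrier_mat (m i) (n i) \<and>
      vec_space.rank (m i) (coeff_row k (m i) (L * ?H i 1) (\<lambda>s. L * ?H i (s + 1))) \<le> n i \<and>
      (\<forall>Ah Bh. Ah \<in> carrier_mat (m i) (n i) \<longrightarrow> (\<forall>s\<in>{1..k}. Bh s \<in> carrier_mat (m i) (n i)) \<longrightarrow>
        vec_space.rank (m i) (coeff_row k (m i) Ah Bh) \<le> n i \<longrightarrow>
        (frobenius_norm (coeff_row k (m i) (L * ?H i 1 - A i) (\<lambda>s. L * ?H i (s + 1) - B i s)))\<^sup>2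
        \<le> (frobenius_norm (coeff_row k (m i) (Ah - A i) (\<lambda>s. Bh s - B i s)))\<^sup>2)" for i L
  have "\<exists>L. best i L" if i: "i \<in> {1..k}" for i
    unfolding best_def
    by (rule best_low_rank_coeff_row[OF assms(5)[OF i] assms(2)[OF i] A[OF i] B[OF i]])
  then obtain L where best: "\<And>i. i \<in> {1..k} \<Longrightarrow> best i (L i)" by metis
  have L: "L i \<in> carrier_mat (m i) (n i)" if "i \<in> {1..k}" for i
    using best[OF that] unfolding best_def by (rule conjunct1)
  \<comment> \<open>\<open>A0\<close> and \<open>B0\<close> are the blocks of the truncated SVDs,
    the common minimiser of the two problems.\<close>
  define A0 where "A0 i = L i * ?H i 1" for i
  define B0 where "B0 i s = L i * ?H i (s + 1)" for i s
  have coeffs: "mep_coeffs k m n A0 B0"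
    unfolding mep_coeffs_def A0_def B0_def using L H by (auto intro!: mult_carrier_mat)
  have rank: "rank_constraint k m n A0 B0"
    using best unfolding rank_constraint_def A0_def B0_def best_def by (intro ballI) blast
  \<comment> \<open>The cost and the rank constraint separate over \<open>i\<close>, so the
    optimality of each \<open>L i\<close> gives that of the whole point.\<close>
  have cost: "perturbation_cost k m A B A0 B0 \<le> perturbation_cost k m A B Ah Bh"
    if "mep_coeffs k m n Ah Bh" "rank_constraint k m n Ah Bh" for Ah Bh
    unfolding perturbation_cost_def A0_def B0_def
  proof (rule sum_mono)
    fix i assume i: "i \<in> {1..k}"
    have "Ah i \<in> carrier_mat (m i) (n i)" "\<forall>s\<in>{1..k}. Bh i s \<in> carrier_mat (m i) (n i)"
      "vec_space.rank (m i) (coeff_row k (m i) (Ah i) (Bh i)) \<le> n i"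
      using that i unfolding mep_coeffs_def rank_constraint_def by blast+
    then show "(frobenius_norm (coeff_row k (m i) (L i * ?H i 1 - A i) (\<lambda>s. L i * ?H i (s + 1) - B i s)))\<^sup>2
        \<le> (frobenius_norm (coeff_row k (m i) (Ah i - A i) (\<lambda>s. Bh i s - B i s)))\<^sup>2"
      using best[OF i, unfolded best_def, THEN conjunct2, THEN conjunct2] by blast
  qed
  have "\<exists>X. (\<forall>s. X s \<in> carrier_mat (n i) (n i)) \<and>
      A0 i = finsum (module_mat TYPE(complex) (m i) (n i)) (\<lambda>s. B0 i s * X s) {1..k}"
    if i: "i \<in> {1..k}" for i
    unfolding A0_def B0_def
    by (rule mult_first_block_eq_finsum[OF _ _ assms(6)[OF i] L[OF i]])
      (use assms(5)[OF i] in \<open>auto simp: svd_split_def\<close>)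
  then obtain X where X: "\<And>i s. i \<in> {1..k} \<Longrightarrow> X i s \<in> carrier_mat (n i) (n i)"
    "\<And>i. i \<in> {1..k} \<Longrightarrow> A0 i = finsum (module_mat TYPE(complex) (m i) (n i)) (\<lambda>s. B0 i s * X i s) {1..k}"
    by metis
  obtain lam x where "indep_eigentuples k n n (\<lambda>i. ?H i 1) (\<lambda>i s. ?H i (s + 1)) N lam x"
    using assms(7) by blast
  from indep_eigentuples_mult_left[OF this H H L]
  have eig: "indep_eigentuples k m n A0 B0 N lam x" unfolding A0_def B0_def .
  \<comment> \<open>Feasibility through \<open>X\<close> bounds the infimum from above; from below,
    every feasible point satisfies the hypotheses of \<open>cost\<close>.\<close>
  have "phi k m n A B = ereal (perturbation_cost k m A B A0 B0)"
    unfolding phi_def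
  proof (rule antisym)
    show "Inf {ereal (perturbation_cost k m A B Ah Bh) | Ah Bh X. mep_coeffs k m n Ah Bh \<and>
        (\<forall>i\<in>{1..k}. \<forall>s\<in>{1..k}. X i s \<in> carrier_mat (n i) (n i)) \<and>
        (\<forall>i\<in>{1..k}. Ah i = finsum (module_mat TYPE(complex) (m i) (n i)) (\<lambda>s. Bh i s * X i s) {1..k}) \<and>
        rank_constraint k m n Ah Bh} \<le> ereal (perturbation_cost k m A B A0 B0)"
      using coeffs rank X by (intro Inf_lower) blast
  qed (use cost in \<open>auto intro!: Inf_greatest\<close>)
  \<comment> \<open>The same two bounds, with feasibility now witnessed by the eigentuples
    \<open>lam\<close> and \<open>x\<close> of the square problem.\<close>
  moreover have "theta_tilde k m n A B N = ereal (perturbation_cost k m A B A0 B0)"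
    unfolding theta_tilde_def
  proof (rule antisym)
    show "Inf {ereal (perturbation_cost k m A B Ah Bh) | Ah Bh lam x. mep_coeffs k m n Ah Bh \<and>
        indep_eigentuples k m n Ah Bh N lam x \<and> rank_constraint k m n Ah Bh}
      \<le> ereal (perturbation_cost k m A B A0 B0)"
      using coeffs rank eig by (intro Inf_lower) blast
  qed (use cost in \<open>auto intro!: Inf_greatest\<close>)
  ultimately show ?thesis by simp
qed

end
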